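(* Let $\Xi\sim\mathrm{PIP}(\beta,\varphi)$ be a stationary and isotropic pairwise interaction process on $\mathbb{R}^d$ that is inhibitory and has finite interaction range, with intensity $\lambda$. For $x\in\mathbb{R}^d$ put $\tilde G_x=\int_{\mathbb{R}^d}\bigl[1-\varphi(y)\varphi(y-x)\bigr]\,dy$. Then the pair correlation function $\rho$ of $\Xi$ satisfies, for $x\in\mathbb{R}^d$, $$L(x):=\varphi(x)\Bigl(\frac{\beta^2}{\lambda^2}-\frac{\beta^2\tilde G_x}{\lambda}\Bigr)\;\le\;\rho(\|x\|)\;\le\;U(x):=\varphi(x)\Bigl(\frac{\beta^2}{\lambda^2}-\frac{\beta}{\lambda}\bigl(1-\exp(-\beta\tilde G_x)\bigr)\Bigr),$$ and integration of these inequalities yields bounds on the $K$ function: for every $t\ge0$ and any fixed unit vector $e\in\mathbb{R}^d$, $$\alpha_d d\int_0^t s^{d-1}L(se)\,ds\;\le\;K(t)\;\le\;\alpha_d d\int_0^t s^{d-1}U(se)\,ds,$$ where $\alpha_d$ denotes the volume of the unit ball in $\mathbb{R}^d$.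
   Context: Let $\mathfrak{N}$ be the space of locally finite point measures on $\mathbb{R}^d$ with the $\sigma$-algebra generated by the evaluation maps $\xi\mapsto\xi(A)$, $A$ bounded Borel. A point process is a random element of $\mathfrak{N}$; all point processes are simple, so configurations are identified with locally finite sets. A point process $\Xi$ on $\mathbb{R}^d$ is a Gibbs process with conditional intensity $\lambda(\cdot\mid\cdot)\colon\mathbb{R}^d\times\mathfrak{N}\to[0,\infty)$ (measurable) if $$\mathbb{E}\Bigl(\int_{\mathbb{R}^d} h(x,\Xi\setminus\{x\})\,\Xi(dx)\Bigr)=\int_{\mathbb{R}^d}\mathbb{E}\bigl(h(x,\Xi)\lambda(x\mid\Xi)\bigr)\,dx$$ for all measurable $h\colon\mathbb{R}^d\times\mathfrak{N}\to[0,\infty)$. $\Xi$ need not be uniquely determined by $\lambda(\cdot\mid\cdot)$; results hold for every such process. $\Xi$ is stationary if its distribution is invariant under translations, and isotropic if it is also invariant under rotations. $\Xi\sim\mathrm{PIP}(\beta,\varphi)$ (stationary pairwise interaction process) means that $\Xi$ is a stationary Gibbs process with conditional intensity $\lambda(x\mid\xi)=\beta\prod_{y\in\xi}\varphi(x-y)$, where $\beta>0$ is a constant and $\varphi\colon\mathbb{R}^d\to[0,\infty)$ is a measurable interaction function with $\varphi(-x)=\varphi(x)$. In the isotropic case $\varphi(x)$ is taken to depend only on $\|x\|$. The process is inhibitory if $\varphi\le1$ and has finite interaction range if $1-\varphi$ is compactly supported. The intensity of $\Xi$ is the constant $\lambda=\mathbb{E}(\lambda(0\mid\Xi))$, i.e.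 $\mathbb{E}\,\Xi(A)=\lambda|A|$ for Borel sets $A$. The second correlation function $\lambda_2$ is the density with respect to Lebesgue measure on $(\mathbb{R}^d)^2$ of the second factorial moment measure $A\mapsto\mathbb{E}\sum_{X_1,X_2\in\Xi,\,X_1\ne X_2}\mathbf{1}\{(X_1,X_2)\in A\}$. For $\Xi\sim\mathrm{PIP}(\beta,\varphi)$ the version used is $$\lambda_2(x_1,x_2)=\beta^2\varphi(x_1-x_2)\,\mathbb{E}\Bigl(\prod_{y\in\Xi}\varphi(y-x_1)\varphi(y-x_2)\Bigr).$$ In the stationary isotropic case the pair correlation function is $\rho(s)=\lambda_2(x,y)/\lambda^2$ with $s=\|x-y\|$, and the $K$ function is $K(t)=\alpha_d d\int_0^t s^{d-1}\rho(s)\,ds$. *)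

theory Defs
  imports "HOL-Probability.Probability"
begin

section \<open>Configurations and point processes\<close>

text \<open>A simple locally finite point measure is identified with its support. The evaluation
  map at \<open>A\<close> is then \<open>\<lambda>\<xi>. card (\<xi> \<inter> A)\<close>.\<close>

definition locally_finite :: "'a::metric_space set \<Rightarrow> bool" where
  "locally_finite \<xi> \<longleftrightarrow> (\<forall>B. bounded B \<longrightarrow> finite (\<xi> \<inter> B))"

definition config_space :: "'a::euclidean_space set measure" where
  "config_space = sigma {\<xi>. locally_finite \<xi>}
     {{\<xi>. locally_finite \<xi> \<and> card (\<xi> \<inter> A) \<in> N} | A N. A \<in> sets borel \<and> bounded A}"

definition point_process :: "'w measure \<Rightarrow> ('w \<Rightarrow> 'a::euclidean_space set) \<Rightarrow> bool" where
  "point_process M \<Xi> \<longleftrightarrow> prob_space M \<and> \<Xi> \<in> measurable M config_space"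

definition stationary :: "'w measure \<Rightarrow> ('w \<Rightarrow> 'a::euclidean_space set) \<Rightarrow> bool" where
  "stationary M \<Xi> \<longleftrightarrow>
     (\<forall>v. distr M config_space (\<lambda>\<omega>. (\<lambda>y. y + v) ` \<Xi> \<omega>) = distr M config_space \<Xi>)"

definition isotropic :: "'w measure \<Rightarrow> ('w \<Rightarrow> (real ^ 'n) set) \<Rightarrow> bool" where
  "isotropic M \<Xi> \<longleftrightarrow> stationary M \<Xi> \<and>
     (\<forall>Q. rotation_matrix Q \<longrightarrow>
        distr M config_space (\<lambda>\<omega>. (\<lambda>y. Q *v y) ` \<Xi> \<omega>) = distr M config_space \<Xi>)"


section \<open>Gibbs processes and pairwise interaction processes\<close>

definition gibbs_process ::
  "'w measure \<Rightarrow> ('w \<Rightarrow> 'a::euclidean_space set) \<Rightarrow> ('a \<Rightarrow> 'a set \<Rightarrow> real) \<Rightarrow> bool" where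
  "gibbs_process M \<Xi> ci \<longleftrightarrow> point_process M \<Xi> \<and>
     (\<lambda>(x, \<xi>). ci x \<xi>) \<in> borel_measurable (borel \<Otimes>\<^sub>M config_space) \<and>
     (\<forall>x. \<forall>\<xi>\<in>space config_space. 0 \<le> ci x \<xi>) \<and>
     (\<forall>h :: 'a \<times> 'a set \<Rightarrow> real. h \<in> borel_measurable (borel \<Otimes>\<^sub>M config_space) \<and> (\<forall>z. 0 \<le> h z) \<longrightarrow>
        (\<integral>\<^sup>+\<omega>. (\<integral>\<^sup>+x. ennreal (h (x, \<Xi> \<omega> - {x})) \<partial>count_space (\<Xi> \<omega>)) \<partial>M)
      = (\<integral>\<^sup>+x. (\<integral>\<^sup>+\<omega>. ennreal (h (x, \<Xi> \<omega>) * ci x (\<Xi> \<omega>)) \<partial>M) \<partial>lborel))"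

text \<open>The library's \<open>prod\<close> is 1 on every infinite index set, so products over a configuration
  are taken as unconditional limits of finite products. If \<open>f = 1\<close> outside a finite subset of
  \<open>\<xi>\<close>, this is the finite product of the remaining factors.\<close>

definition config_prod :: "('a \<Rightarrow> real) \<Rightarrow> 'a set \<Rightarrow> real" where
  "config_prod f \<xi> = Lim (finite_subsets_at_top \<xi>) (\<lambda>F. \<Prod>y\<in>F. f y)"

definition pip_intensity :: "real \<Rightarrow> ('a::euclidean_space \<Rightarrow> real) \<Rightarrow> 'a \<Rightarrow> 'a set \<Rightarrow> real" where
  "pip_intensity \<beta> \<phi> x \<xi> = \<beta> * config_prod (\<lambda>y. \<phi> (x - y)) \<xi>"

definition PIP ::
  "'w measure \<Rightarrow> ('w \<Rightarrow> 'a::euclidean_space set) \<Rightarrow> real \<Rightarrow> ('a \<Rightarrow> real) \<Rightarrow> bool" where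
  "PIP M \<Xi> \<beta> \<phi> \<longleftrightarrow> 0 < \<beta> \<and> \<phi> \<in> borel_measurable borel \<and> (\<forall>x. 0 \<le> \<phi> x) \<and>
     (\<forall>x. \<phi> (- x) = \<phi> x) \<and> stationary M \<Xi> \<and> gibbs_process M \<Xi> (pip_intensity \<beta> \<phi>)"

definition inhibitory :: "('a \<Rightarrow> real) \<Rightarrow> bool" where
  "inhibitory \<phi> \<longleftrightarrow> (\<forall>x. \<phi> x \<le> 1)"

definition finite_range :: "('a::euclidean_space \<Rightarrow> real) \<Rightarrow> bool" where
  "finite_range \<phi> \<longleftrightarrow> compact (closure {x. 1 - \<phi> x \<noteq> 0})"

definition radial :: "('a::real_normed_vector \<Rightarrow> real) \<Rightarrow> bool" where
  "radial \<phi> \<longleftrightarrow> (\<forall>x y. norm x = norm y \<longrightarrow> \<phi> x = \<phi> y)"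

definition intensity ::
  "'w measure \<Rightarrow> ('w \<Rightarrow> 'a::euclidean_space set) \<Rightarrow> ('a \<Rightarrow> 'a set \<Rightarrow> real) \<Rightarrow> real" where
  "intensity M \<Xi> ci = (\<integral>\<omega>. ci 0 (\<Xi> \<omega>) \<partial>M)"


section \<open>Second-order characteristics\<close>

definition factorial_moment2 ::
  "'w measure \<Rightarrow> ('w \<Rightarrow> 'a::euclidean_space set) \<Rightarrow> ('a \<times> 'a) set \<Rightarrow> ennreal" where
  "factorial_moment2 M \<Xi> A =
     (\<integral>\<^sup>+\<omega>. (\<integral>\<^sup>+p. indicator A p \<partial>count_space {(x, y). x \<in> \<Xi> \<omega> \<and> y \<in> \<Xi> \<omega> \<and> x \<noteq> y}) \<partial>M)"

definition is_second_correlation ::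
  "'w measure \<Rightarrow> ('w \<Rightarrow> 'a::euclidean_space set) \<Rightarrow> ('a \<Rightarrow> 'a \<Rightarrow> real) \<Rightarrow> bool" where
  "is_second_correlation M \<Xi> l \<longleftrightarrow>
     (\<lambda>(x, y). l x y) \<in> borel_measurable (borel \<Otimes>\<^sub>M borel) \<and> (\<forall>x y. 0 \<le> l x y) \<and>
     (\<forall>A \<in> sets (borel \<Otimes>\<^sub>M borel).
        factorial_moment2 M \<Xi> A = (\<integral>\<^sup>+(x, y). ennreal (l x y) * indicator A (x, y) \<partial>(lborel \<Otimes>\<^sub>M lborel)))"

text \<open>The density of the second factorial moment measure is determined only almost everywhere;
  for a pairwise interaction process the following version is fixed.\<close>

definition pip_correlation2 ::
  "'w measure \<Rightarrow> ('w \<Rightarrow> 'a::euclidean_space set) \<Rightarrow> real \<Rightarrow> ('a \<Rightarrow> real) \<Rightarrow> 'a \<Rightarrow> 'a \<Rightarrow> real" where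
  "pip_correlation2 M \<Xi> \<beta> \<phi> x1 x2 =
     \<beta>\<^sup>2 * \<phi> (x1 - x2) * (\<integral>\<omega>. config_prod (\<lambda>y. \<phi> (y - x1) * \<phi> (y - x2)) (\<Xi> \<omega>) \<partial>M)"

text \<open>\<open>pair_correlation M \<Xi> \<beta> \<phi> s\<close> is the common value of the quotient over all pairs at
  distance \<open>s \<ge> 0\<close>; stationarity and isotropy make this well defined.\<close>

definition pair_correlation ::
  "'w measure \<Rightarrow> ('w \<Rightarrow> 'a::euclidean_space set) \<Rightarrow> real \<Rightarrow> ('a \<Rightarrow> real) \<Rightarrow> real \<Rightarrow> real" where
  "pair_correlation M \<Xi> \<beta> \<phi> s =
     (THE r. \<forall>x y. norm (x - y) = s \<longrightarrow>
        r = pip_correlation2 M \<Xi> \<beta> \<phi> x y / (intensity M \<Xi> (pip_intensity \<beta> \<phi>))\<^sup>2)"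

text \<open>The unit ball volume and the dimension are those of the type \<open>'a\<close>.\<close>

definition radial_integral :: "'a::euclidean_space itself \<Rightarrow> (real \<Rightarrow> real) \<Rightarrow> real \<Rightarrow> real" where
  "radial_integral _ f t =
     measure lborel (ball (0::'a) 1) * real DIM('a) * (LINT s:{0..t}|lborel. s ^ (DIM('a) - 1) * f s)"

definition K_function ::
  "'w measure \<Rightarrow> ('w \<Rightarrow> 'a::euclidean_space set) \<Rightarrow> real \<Rightarrow> ('a \<Rightarrow> real) \<Rightarrow> real \<Rightarrow> real" where
  "K_function M \<Xi> \<beta> \<phi> t = radial_integral TYPE('a) (pair_correlation M \<Xi> \<beta> \<phi>) t"

definition G_tilde :: "('a::euclidean_space \<Rightarrow> real) \<Rightarrow> 'a \<Rightarrow> real" where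
  "G_tilde \<phi> x = (\<integral>y. 1 - \<phi> y * \<phi> (y - x) \<partial>lborel)"


section \<open>Measurability over configurations\<close>

lemma space_config_space: "space config_space = {\<xi>. locally_finite \<xi>}"
  unfolding config_space_def by (rule space_measure_of) auto

lemma locally_finite_subset: "locally_finite \<xi> \<Longrightarrow> \<eta> \<subseteq> \<xi> \<Longrightarrow> locally_finite \<eta>"
  unfolding locally_finite_def by (meson Int_mono finite_subset order_refl)

lemma locally_finite_insert: "locally_finite \<xi> \<Longrightarrow> locally_finite (insert x \<xi>)"
  unfolding locally_finite_def by (simp add: Int_insert_left)

lemma locally_finite_countable:
  fixes \<xi> :: "'a::metric_space set"
  assumes "locally_finite \<xi>"
  shows "countable \<xi>"
proof -
  have "\<xi> = (\<Union>n. \<xi> \<inter> ball undefined (real n))"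
    by (auto simp: reals_Archimedean2)
  moreover have "countable (\<Union>n. \<xi> \<inter> ball undefined (real n))"
    using assms unfolding locally_finite_def by (intro countable_UN) (auto simp: countable_finite)
  ultimately show ?thesis by simp
qed

lemma measurable_config_card:
  assumes "A \<in> sets borel" "bounded A" "Z \<in> measurable P config_space"
  shows "(\<lambda>p. card (Z p \<inter> A)) \<in> measurable P (count_space UNIV)"
proof (rule measurable_compose[OF assms(3)], rule measurableI)
  fix N :: "nat set"
  have "{\<xi>. locally_finite \<xi> \<and> card (\<xi> \<inter> A) \<in> N} \<in> sets config_space"
    unfolding config_space_def using assms by (subst sets_measure_of) auto
  then show "(\<lambda>\<xi>. card (\<xi> \<inter> A)) -` N \<inter> space config_space \<in> sets config_space"
    by (simp add: space_config_space vimage_def Int_def conj_commute)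
qed simp

lemma measurable_config_spaceI:
  fixes Z :: "'p \<Rightarrow> 'a::euclidean_space set"
  assumes "\<And>p. p \<in> space P \<Longrightarrow> locally_finite (Z p)"
    and "\<And>A. A \<in> sets borel \<Longrightarrow> bounded A \<Longrightarrow> (\<lambda>p. card (Z p \<inter> A)) \<in> measurable P (count_space UNIV)"
  shows "Z \<in> measurable P config_space"
  unfolding config_space_def
proof (rule measurable_measure_of)
  fix y :: "'a set set" assume "y \<in> {{\<xi>. locally_finite \<xi> \<and> card (\<xi> \<inter> A) \<in> N} | A N. A \<in> sets borel \<and> bounded A}"
  then obtain A N where y: "y = {\<xi>. locally_finite \<xi> \<and> card (\<xi> \<inter> A) \<in> N}" "A \<in> sets borel" "bounded A"
    by auto
  have "Z -` y \<inter> space P = (\<lambda>p. card (Z p \<inter> A)) -` N \<inter> space P"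
    using assms(1) y by auto
  also have "\<dots> \<in> sets P" using assms(2)[OF y(2,3)] by (auto simp: measurable_def)
  finally show "Z -` y \<inter> space P \<in> sets P" .
qed (use assms(1) in auto)

lemma config_integral_measurable:
  fixes Z :: "'p \<Rightarrow> 'a::euclidean_space set" and f :: "'p \<Rightarrow> 'a \<Rightarrow> ennreal"
  assumes Z: "Z \<in> measurable P config_space"
    and f: "(\<lambda>(p, x). f p x) \<in> borel_measurable (P \<Otimes>\<^sub>M borel)"
  shows "(\<lambda>p. \<integral>\<^sup>+x. f p x \<partial>count_space (Z p)) \<in> borel_measurable P"
proof -
  define B where "B n = ball (0::'a) (real n)" for n
  define C where "C n p = 1 + real (card (Z p \<inter> B n))" for n p
  define \<kappa> where "\<kappa> n p = scale_measure (ennreal (1 / C n p))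
      (distr (count_space (Z p \<inter> B n)) borel (\<lambda>x. x))" for n p
  have [measurable]: "B n \<in> sets borel" "bounded (B n)" for n by (auto simp: B_def)
  have cardm[measurable]: "(\<lambda>p. card (Z p \<inter> A)) \<in> measurable P (count_space UNIV)"
    if "A \<in> sets borel" "bounded A" for A using measurable_config_card[OF that Z] .
  have [measurable]: "C n \<in> borel_measurable P" for n
    unfolding C_def using cardm[of "B n"] by measurable
  have Cpos: "C n p > 0" for n p unfolding C_def by (auto intro: add_pos_nonneg)
  have fin: "finite (Z p \<inter> B n)" if "p \<in> space P" for n p
    using measurable_space[OF Z that] by (auto simp: space_config_space locally_finite_def B_def)
  have em: "emeasure (\<kappa> n p) A = ennreal (real (card (Z p \<inter> (B n \<inter> A))) / C n p)"
    if "p \<in> space P" "A \<in> sets borel" for n p A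
  proof -
    have "emeasure (distr (count_space (Z p \<inter> B n)) borel (\<lambda>x. x)) A = emeasure (count_space (Z p \<inter> B n)) (A \<inter> (Z p \<inter> B n))"
      using that by (subst emeasure_distr) auto
    also have "\<dots> = ennreal (real (card (Z p \<inter> (B n \<inter> A))))"
      using fin[OF that(1)] by (subst emeasure_count_space_finite) (auto simp: ennreal_of_nat_eq_real_of_nat Int_ac)
    finally show ?thesis
      unfolding \<kappa>_def using Cpos[of n p] by (simp add: ennreal_mult'[symmetric])
  qed
  have \<kappa>: "\<kappa> n \<in> measurable P (subprob_algebra borel)" for n
  proof (rule measurable_subprob_algebra)
    fix p assume p: "p \<in> space P"
    show "subprob_space (\<kappa> n p)"
    proof
      have "emeasure (\<kappa> n p) UNIV \<le> 1" unfolding em[OF p borel_open[OF open_UNIV]]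
        using Cpos[of n p] by (simp add: C_def)
      then show "emeasure (\<kappa> n p) (space (\<kappa> n p)) \<le> 1" by (simp add: \<kappa>_def space_scale_measure)
    qed (simp add: \<kappa>_def space_scale_measure)
    show "sets (\<kappa> n p) = sets borel" by (simp add: \<kappa>_def)
  next
    fix A :: "'a set" assume A: "A \<in> sets borel"
    have b: "bounded (B n \<inter> A)" using \<open>bounded (B n)\<close> by (meson bounded_subset inf_le1)
    have "(\<lambda>p. ennreal (real (card (Z p \<inter> (B n \<inter> A))) / C n p)) \<in> borel_measurable P"
      using cardm[OF _ b] A by measurable
    then show "(\<lambda>p. emeasure (\<kappa> n p) A) \<in> borel_measurable P"
      using em[OF _ A] by (simp cong: measurable_cong)
  qed
  have split: "(\<integral>\<^sup>+x. f p x \<partial>count_space (Z p)) = (SUP n. ennreal (C n p) * (\<integral>\<^sup>+x. f p x \<partial>\<kappa> n p))"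
    if p: "p \<in> space P" for p
  proof -
    have fm: "f p \<in> borel_measurable borel" using measurable_compose[OF measurable_Pair1'[OF p] f] by simp
    have "ennreal (C n p) * (\<integral>\<^sup>+x. f p x \<partial>\<kappa> n p) = (\<integral>\<^sup>+x. f p x * indicator (B n) x \<partial>count_space (Z p))" for n
    proof -
      have "(\<integral>\<^sup>+x. f p x \<partial>\<kappa> n p) = ennreal (1 / C n p) * (\<integral>\<^sup>+x. f p x \<partial>count_space (Z p \<inter> B n))"
        unfolding \<kappa>_def using fm by (subst nn_integral_scale_measure) (auto simp: nn_integral_distr)
      then have "ennreal (C n p) * (\<integral>\<^sup>+x. f p x \<partial>\<kappa> n p) = (\<integral>\<^sup>+x. f p x \<partial>count_space (Z p \<inter> B n))"
        using Cpos[of n p] by (simp add: mult.assoc[symmetric] ennreal_mult'[symmetric])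
      also have "\<dots> = (\<integral>\<^sup>+x. f p x * indicator (Z p \<inter> B n) x \<partial>count_space UNIV)"
        by (simp add: nn_integral_count_space_indicator)
      also have "\<dots> = (\<integral>\<^sup>+x. f p x * indicator (B n) x * indicator (Z p) x \<partial>count_space UNIV)"
        by (intro nn_integral_cong) (auto simp: indicator_def)
      also have "\<dots> = (\<integral>\<^sup>+x. f p x * indicator (B n) x \<partial>count_space (Z p))"
        by (simp add: nn_integral_count_space_indicator)
      finally show ?thesis .
    qed
    moreover have "(SUP n. \<integral>\<^sup>+x. f p x * indicator (B n) x \<partial>count_space (Z p))
        = (\<integral>\<^sup>+x. (SUP n. f p x * indicator (B n) x) \<partial>count_space (Z p))"
      by (intro nn_integral_monotone_convergence_SUP[symmetric])
        (auto simp: incseq_def le_fun_def B_def indicator_def)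
    moreover have "(SUP n. f p x * indicator (B n) x) = f p x" for x
    proof (rule antisym)
      obtain n where "norm x < real n" using reals_Archimedean2 by blast
      then have "f p x * indicator (B n) x = f p x" by (simp add: B_def)
      then show "f p x \<le> (SUP n. f p x * indicator (B n) x)" by (metis SUP_upper UNIV_I)
    qed (auto intro!: SUP_least simp: indicator_def)
    ultimately show ?thesis by simp
  qed
  have "(\<lambda>p. SUP n. ennreal (C n p) * (\<integral>\<^sup>+x. f p x \<partial>\<kappa> n p)) \<in> borel_measurable P"
    using nn_integral_measurable_subprob_algebra2[OF f \<kappa>] by measurable
  then show ?thesis using split by (simp cong: measurable_cong)
qed

lemma config_member_measurable:
  fixes Z :: "'p \<Rightarrow> 'a::euclidean_space set"
  assumes Z: "Z \<in> measurable P config_space" and g[measurable]: "g \<in> borel_measurable P"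
  shows "(\<lambda>p. indicator (Z p) (g p) :: ennreal) \<in> borel_measurable P"
proof -
  have "(\<lambda>p. \<integral>\<^sup>+x. indicator {(p, x). x = g p} (p, x) \<partial>count_space (Z p)) \<in> borel_measurable P"
  proof (rule config_integral_measurable[OF Z])
    have "(\<lambda>q. indicator {0} (snd q - g (fst q)) :: ennreal) \<in> borel_measurable (P \<Otimes>\<^sub>M borel)"
      by measurable
    then show "(\<lambda>(p, x). indicator {(p, x). x = g p} (p, x) :: ennreal) \<in> borel_measurable (P \<Otimes>\<^sub>M borel)"
      by (auto simp: indicator_def case_prod_beta cong: if_cong)
  qed
  moreover have "(\<integral>\<^sup>+x. indicator {(p, x). x = g p} (p, x) \<partial>count_space (Z p)) = (indicator (Z p) (g p) :: ennreal)" for p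
  proof -
    have "(\<integral>\<^sup>+x. indicator {(p, x). x = g p} (p, x) \<partial>count_space (Z p))
       = (\<integral>\<^sup>+x. (indicator (Z p) (g p) :: ennreal) * indicator {g p} x \<partial>count_space UNIV)"
      by (subst nn_integral_count_space_indicator, simp, rule nn_integral_cong, auto simp: indicator_def)
    also have "\<dots> = indicator (Z p) (g p)" by (subst nn_integral_cmult_indicator) auto
    finally show ?thesis .
  qed
  ultimately show ?thesis by simp
qed

lemma config_member_pred:
  fixes Z :: "'p \<Rightarrow> 'a::euclidean_space set"
  assumes Z: "Z \<in> measurable P config_space" and g[measurable]: "g \<in> borel_measurable P"
  shows "Measurable.pred P (\<lambda>p. g p \<in> Z p)"
proof -
  have "Measurable.pred P (\<lambda>p. (indicator (Z p) (g p) :: ennreal) = 1)"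
    using config_member_measurable[OF Z g] by measurable
  then show ?thesis by (simp add: indicator_def)
qed

lemma config_remove_measurable:
  fixes Z :: "'p \<Rightarrow> 'a::euclidean_space set"
  assumes Z: "Z \<in> measurable P config_space" and g[measurable]: "g \<in> borel_measurable P"
  shows "(\<lambda>p. Z p - {g p}) \<in> measurable P config_space"
proof (rule measurable_config_spaceI)
  fix A :: "'a set" assume A: "A \<in> sets borel" "bounded A"
  note [measurable] = config_member_pred[OF Z g] measurable_config_card[OF A Z] A(1)
  have "(\<lambda>p. card (Z p \<inter> A) - (if g p \<in> Z p \<and> g p \<in> A then 1 else 0)) \<in> measurable P (count_space UNIV)"
    by measurable
  moreover have "card ((Z p - {g p}) \<inter> A) = card (Z p \<inter> A) - (if g p \<in> Z p \<and> g p \<in> A then 1 else 0)" for p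
    by (cases "g p \<in> Z p \<inter> A") (auto simp: Diff_Int_distrib2 Int_insert_left intro!: arg_cong[where f=card])
  ultimately show "(\<lambda>p. card ((Z p - {g p}) \<inter> A)) \<in> measurable P (count_space UNIV)" by simp
qed (use measurable_space[OF Z] in \<open>auto simp: space_config_space intro: locally_finite_subset\<close>)

lemma config_insert_measurable:
  fixes Z :: "'p \<Rightarrow> 'a::euclidean_space set"
  assumes Z: "Z \<in> measurable P config_space" and g[measurable]: "g \<in> borel_measurable P"
  shows "(\<lambda>p. insert (g p) (Z p)) \<in> measurable P config_space"
proof (rule measurable_config_spaceI)
  fix A :: "'a set" assume A: "A \<in> sets borel" "bounded A"
  note [measurable] = config_member_pred[OF Z g] measurable_config_card[OF A Z] A(1)
  have "(\<lambda>p. card (Z p \<inter> A) + (if g p \<notin> Z p \<and> g p \<in> A then 1 else 0)) \<in> measurable P (count_space UNIV)"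
    by measurable
  moreover have "card (insert (g p) (Z p) \<inter> A) = card (Z p \<inter> A) + (if g p \<notin> Z p \<and> g p \<in> A then 1 else 0)"
    if "p \<in> space P" for p
    using measurable_space[OF Z that] A(2)
    by (auto simp: space_config_space locally_finite_def Int_insert_left card_insert_if)
  ultimately show "(\<lambda>p. card (insert (g p) (Z p) \<inter> A)) \<in> measurable P (count_space UNIV)"
    by (simp cong: measurable_cong)
qed (use measurable_space[OF Z] in \<open>auto simp: space_config_space intro: locally_finite_insert\<close>)


section \<open>Consistency of the definitions\<close>

lemma config_prod_finite:
  assumes "finite S" "S \<subseteq> \<xi>" "\<And>y. y \<in> \<xi> - S \<Longrightarrow> f y = 1"
  shows "config_prod f \<xi> = (\<Prod>y\<in>S. f y)"
  unfolding config_prod_def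
proof (rule tendsto_Lim)
  have "eventually (\<lambda>F. (\<Prod>y\<in>F. f y) = (\<Prod>y\<in>S. f y)) (finite_subsets_at_top \<xi>)"
    unfolding eventually_finite_subsets_at_top
    using assms by (intro exI[of _ S]) (auto intro!: prod.mono_neutral_right)
  then show "((\<lambda>F. \<Prod>y\<in>F. f y) \<longlongrightarrow> (\<Prod>y\<in>S. f y)) (finite_subsets_at_top \<xi>)"
    by (rule tendsto_eventually)
qed simp

lemma finite_range_bounded: "finite_range \<phi> \<Longrightarrow> bounded {x. \<phi> x \<noteq> 1}"
  unfolding finite_range_def
  by (drule compact_imp_bounded, rule bounded_subset, assumption) (use closure_subset in fastforce)

lemma finite_range_finite:
  fixes \<phi> :: "'a::euclidean_space \<Rightarrow> real"
  assumes "finite_range \<phi>" "locally_finite \<xi>"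
  shows "finite {y\<in>\<xi>. \<phi> (x - y) \<noteq> 1}"
proof -
  have "bounded ((\<lambda>z. x - z) ` {x. \<phi> x \<noteq> 1})"
    using bounded_linear_image[OF finite_range_bounded[OF assms(1)] bounded_linear_minus[OF bounded_linear_ident]]
      bounded_translation[of "uminus ` {x. \<phi> x \<noteq> 1}" x]
    by (simp add: image_image)
  then have "finite (\<xi> \<inter> (\<lambda>z. x - z) ` {x. \<phi> x \<noteq> 1})"
    using assms(2) by (simp add: locally_finite_def)
  moreover have "{y\<in>\<xi>. \<phi> (x - y) \<noteq> 1} \<subseteq> \<xi> \<inter> (\<lambda>z. x - z) ` {x. \<phi> x \<noteq> 1}"
  proof
    fix y assume "y \<in> {y\<in>\<xi>. \<phi> (x - y) \<noteq> 1}"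
    then show "y \<in> \<xi> \<inter> (\<lambda>z. x - z) ` {x. \<phi> x \<noteq> 1}" by (auto intro!: image_eqI[of _ _ "x - y"])
  qed
  ultimately show ?thesis by (rule finite_subset[rotated])
qed

lemma pip_intensity_finite:
  fixes \<phi> :: "'a::euclidean_space \<Rightarrow> real"
  assumes "finite S" "S \<subseteq> \<xi>" "{y\<in>\<xi>. \<phi> (x - y) \<noteq> 1} \<subseteq> S"
  shows "pip_intensity \<beta> \<phi> x \<xi> = \<beta> * (\<Prod>y\<in>S. \<phi> (x - y))"
  unfolding pip_intensity_def using assms by (subst config_prod_finite[of S]) auto

lemma pip_intensity_bounds:
  fixes \<phi> :: "'a::euclidean_space \<Rightarrow> real"
  assumes "finite_range \<phi>" "locally_finite \<xi>" "\<And>x. 0 \<le> \<phi> x" "inhibitory \<phi>" "0 \<le> \<beta>"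
  shows "0 \<le> pip_intensity \<beta> \<phi> x \<xi>" "pip_intensity \<beta> \<phi> x \<xi> \<le> \<beta>"
proof -
  have "pip_intensity \<beta> \<phi> x \<xi> = \<beta> * (\<Prod>y\<in>{y\<in>\<xi>. \<phi> (x - y) \<noteq> 1}. \<phi> (x - y))"
    by (rule pip_intensity_finite[OF finite_range_finite[OF assms(1,2)]]) auto
  moreover have "0 \<le> (\<Prod>y\<in>{y\<in>\<xi>. \<phi> (x - y) \<noteq> 1}. \<phi> (x - y))"
    "(\<Prod>y\<in>{y\<in>\<xi>. \<phi> (x - y) \<noteq> 1}. \<phi> (x - y)) \<le> 1"
    using assms(3,4) by (auto intro!: prod_nonneg prod_le_1 simp: inhibitory_def)
  ultimately show "0 \<le> pip_intensity \<beta> \<phi> x \<xi>" "pip_intensity \<beta> \<phi> x \<xi> \<le> \<beta>"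
    using assms(5) by (auto simp: mult_left_le)
qed

lemma pip_intensity_insert:
  fixes \<phi> :: "'a::euclidean_space \<Rightarrow> real"
  assumes "finite_range \<phi>" "locally_finite \<xi>" "y \<notin> \<xi>"
  shows "pip_intensity \<beta> \<phi> x (insert y \<xi>) = \<phi> (x - y) * pip_intensity \<beta> \<phi> x \<xi>"
proof -
  let ?S = "{y\<in>\<xi>. \<phi> (x - y) \<noteq> 1}"
  have f: "finite ?S" by (rule finite_range_finite[OF assms(1,2)])
  have "pip_intensity \<beta> \<phi> x \<xi> = \<beta> * (\<Prod>y\<in>?S. \<phi> (x - y))"
    by (rule pip_intensity_finite[OF f]) auto
  moreover have "pip_intensity \<beta> \<phi> x (insert y \<xi>) = \<beta> * (\<Prod>y\<in>insert y ?S. \<phi> (x - y))"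
    using f by (intro pip_intensity_finite) auto
  ultimately show ?thesis using f assms(3) by simp
qed

lemma pip_intensity_mult:
  fixes \<phi> :: "'a::euclidean_space \<Rightarrow> real"
  assumes "finite_range \<phi>" "locally_finite \<xi>" "\<And>x. \<phi> (- x) = \<phi> x"
  shows "pip_intensity \<beta> \<phi> x1 \<xi> * pip_intensity \<beta> \<phi> x2 \<xi> =
    \<beta>\<^sup>2 * config_prod (\<lambda>y. \<phi> (y - x1) * \<phi> (y - x2)) \<xi>"
proof -
  let ?S = "{y\<in>\<xi>. \<phi> (x1 - y) \<noteq> 1} \<union> {y\<in>\<xi>. \<phi> (x2 - y) \<noteq> 1}"
  have f: "finite ?S" using finite_range_finite[OF assms(1,2)] by simp
  have sym: "\<phi> (y - x) = \<phi> (x - y)" for x y using assms(3)[of "x - y"] by simp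
  have "pip_intensity \<beta> \<phi> x1 \<xi> = \<beta> * (\<Prod>y\<in>?S. \<phi> (x1 - y))"
    "pip_intensity \<beta> \<phi> x2 \<xi> = \<beta> * (\<Prod>y\<in>?S. \<phi> (x2 - y))"
    by (rule pip_intensity_finite[OF f]; auto)+
  moreover have "config_prod (\<lambda>y. \<phi> (y - x1) * \<phi> (y - x2)) \<xi> = (\<Prod>y\<in>?S. \<phi> (y - x1) * \<phi> (y - x2))"
    using f by (rule config_prod_finite) (auto simp: sym)
  ultimately show ?thesis by (simp add: sym prod.distrib power2_eq_square)
qed

lemma gibbs_process_ennreal:
  fixes \<Xi> :: "'w \<Rightarrow> 'a::euclidean_space set" and h :: "'a \<times> 'a set \<Rightarrow> ennreal"
  assumes gibbs: "gibbs_process M \<Xi> ci"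
    and h[measurable]: "h \<in> borel_measurable (borel \<Otimes>\<^sub>M config_space)"
  shows "(\<integral>\<^sup>+\<omega>. (\<integral>\<^sup>+x. h (x, \<Xi> \<omega> - {x}) \<partial>count_space (\<Xi> \<omega>)) \<partial>M)
       = (\<integral>\<^sup>+x. (\<integral>\<^sup>+\<omega>. h (x, \<Xi> \<omega>) * ennreal (ci x (\<Xi> \<omega>)) \<partial>M) \<partial>lborel)"
proof -
  interpret prob_space M using gibbs by (simp add: gibbs_process_def point_process_def)
  have \<Xi>[measurable]: "\<Xi> \<in> measurable M config_space"
    and ci[measurable]: "(\<lambda>z. ci (fst z) (snd z)) \<in> borel_measurable (borel \<Otimes>\<^sub>M config_space)"
    and ci0: "\<And>x \<xi>. \<xi> \<in> space config_space \<Longrightarrow> 0 \<le> ci x \<xi>"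
    using gibbs by (auto simp: gibbs_process_def point_process_def case_prod_beta')
  define k where "k n z = enn2real (min (h z) (of_nat n))" for n z
  have ek: "ennreal (k n z) = min (h z) (of_nat n)" for n z
    unfolding k_def by (rule ennreal_enn2real) (metis ennreal_of_nat_eq_real_of_nat ennreal_less_top min_less_iff_disj)
  have km[measurable]: "k n \<in> borel_measurable (borel \<Otimes>\<^sub>M config_space)" for n
    unfolding k_def by measurable
  have "k n \<in> borel_measurable (borel \<Otimes>\<^sub>M config_space) \<and> (\<forall>z. 0 \<le> k n z)" for n
    using km by (simp add: k_def)
  then have G: "(\<integral>\<^sup>+\<omega>. (\<integral>\<^sup>+x. ennreal (k n (x, \<Xi> \<omega> - {x})) \<partial>count_space (\<Xi> \<omega>)) \<partial>M)
      = (\<integral>\<^sup>+x. (\<integral>\<^sup>+\<omega>. ennreal (k n (x, \<Xi> \<omega>) * ci x (\<Xi> \<omega>)) \<partial>M) \<partial>lborel)" for n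
    using gibbs unfolding gibbs_process_def by blast
  have inc: "incseq (\<lambda>n. ennreal (k n z))" for z
    unfolding ek by (auto simp: incseq_def min.coboundedI2)
  have sup: "(SUP n. ennreal (k n z)) = h z" for z
  proof (rule antisym)
    show "h z \<le> (SUP n. ennreal (k n z))"
    proof (cases "h z = \<top>")
      case True
      then have "(SUP n. ennreal (k n z)) = (SUP n. of_nat n)"
        unfolding ek by (simp add: min_def top_unique)
      then show ?thesis by (simp only: ennreal_SUP_of_nat_eq_top top_greatest)
    next
      case False
      then obtain n :: nat where "h z \<le> of_nat n"
        using ennreal_Ex_less_of_nat[of "h z"] by (metis top.not_eq_extremum less_imp_le)
      then show ?thesis by (intro SUP_upper2[of n]) (simp_all add: ek)
    qed
  qed (auto intro!: SUP_least simp: ek)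
  have fm[measurable]: "(\<lambda>\<omega>. \<integral>\<^sup>+x. ennreal (k n (x, \<Xi> \<omega> - {x})) \<partial>count_space (\<Xi> \<omega>)) \<in> borel_measurable M" for n
  proof (rule config_integral_measurable[OF \<Xi>])
    have "(\<lambda>z. \<Xi> (fst z) - {snd z}) \<in> measurable (M \<Otimes>\<^sub>M borel) config_space"
      by (rule config_remove_measurable) measurable
    then show "(\<lambda>(\<omega>, x). ennreal (k n (x, \<Xi> \<omega> - {x}))) \<in> borel_measurable (M \<Otimes>\<^sub>M borel)"
      unfolding case_prod_beta' by measurable
  qed
  have prm[measurable]: "(\<lambda>p. (fst p, \<Xi> (snd p))) \<in> measurable (borel \<Otimes>\<^sub>M M) (borel \<Otimes>\<^sub>M config_space)"
    by measurable
  have cim: "(\<lambda>p. ci (fst p) (\<Xi> (snd p))) \<in> borel_measurable (borel \<Otimes>\<^sub>M M)"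
    using measurable_compose[OF prm ci] by simp
  have im: "(\<lambda>x. \<integral>\<^sup>+\<omega>. ennreal (k n (x, \<Xi> \<omega>)) * ennreal (ci x (\<Xi> \<omega>)) \<partial>M) \<in> borel_measurable borel" for n
    using cim measurable_compose[OF prm km]
    by (intro borel_measurable_nn_integral) (simp add: case_prod_beta')
  have cixm: "(\<lambda>\<omega>. ennreal (k n (x, \<Xi> \<omega>)) * ennreal (ci x (\<Xi> \<omega>))) \<in> borel_measurable M" for x n
    using measurable_compose[OF measurable_Pair1'[of x borel M] cim]
      measurable_compose[OF measurable_Pair1'[of x borel M] measurable_compose[OF prm km[of n]]]
    by simp
  have "(\<integral>\<^sup>+\<omega>. (\<integral>\<^sup>+x. h (x, \<Xi> \<omega> - {x}) \<partial>count_space (\<Xi> \<omega>)) \<partial>M)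
      = (\<integral>\<^sup>+\<omega>. (SUP n. \<integral>\<^sup>+x. ennreal (k n (x, \<Xi> \<omega> - {x})) \<partial>count_space (\<Xi> \<omega>)) \<partial>M)"
    unfolding sup[symmetric]
    by (intro nn_integral_cong nn_integral_monotone_convergence_SUP) (use inc in \<open>auto simp: incseq_def le_fun_def\<close>)
  also have "\<dots> = (SUP n. \<integral>\<^sup>+\<omega>. \<integral>\<^sup>+x. ennreal (k n (x, \<Xi> \<omega> - {x})) \<partial>count_space (\<Xi> \<omega>) \<partial>M)"
    using inc by (intro nn_integral_monotone_convergence_SUP fm) (auto simp: incseq_def le_fun_def intro!: nn_integral_mono)
  also have "\<dots> = (SUP n. \<integral>\<^sup>+x. \<integral>\<^sup>+\<omega>. ennreal (k n (x, \<Xi> \<omega>)) * ennreal (ci x (\<Xi> \<omega>)) \<partial>M \<partial>lborel)"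
    unfolding G using measurable_space[OF \<Xi>]
    by (intro SUP_cong nn_integral_cong) (auto intro!: ennreal_mult' simp: k_def ci0)
  also have "\<dots> = (\<integral>\<^sup>+x. (SUP n. \<integral>\<^sup>+\<omega>. ennreal (k n (x, \<Xi> \<omega>)) * ennreal (ci x (\<Xi> \<omega>)) \<partial>M) \<partial>lborel)"
    using inc
    by (intro nn_integral_monotone_convergence_SUP[symmetric])
      (auto simp: incseq_def le_fun_def im intro!: nn_integral_mono mult_right_mono)
  also have "\<dots> = (\<integral>\<^sup>+x. \<integral>\<^sup>+\<omega>. (SUP n. ennreal (k n (x, \<Xi> \<omega>)) * ennreal (ci x (\<Xi> \<omega>))) \<partial>M \<partial>lborel)"
    using inc
    by (intro nn_integral_cong nn_integral_monotone_convergence_SUP[symmetric])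
      (auto simp: incseq_def le_fun_def cixm intro!: mult_right_mono)
  also have "\<dots> = (\<integral>\<^sup>+x. (\<integral>\<^sup>+\<omega>. h (x, \<Xi> \<omega>) * ennreal (ci x (\<Xi> \<omega>)) \<partial>M) \<partial>lborel)"
    by (simp add: SUP_mult_right_ennreal[symmetric] sup)
  finally show ?thesis .
qed

lemma config_translate_measurable:
  fixes Z :: "'p \<Rightarrow> 'a::euclidean_space set"
  assumes Z: "Z \<in> measurable P config_space"
  shows "(\<lambda>p. (\<lambda>y. y + v) ` Z p) \<in> measurable P config_space"
proof (rule measurable_config_spaceI)
  have vim: "(\<lambda>y. y + v) ` S \<inter> A = (\<lambda>y. y + v) ` (S \<inter> (\<lambda>y. y - v) ` A)" for S A
    by (force simp: image_iff)
  have bd: "bounded ((\<lambda>y. y - v) ` A)" if "bounded A" for A :: "'a set"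
    using bounded_translation_minus[OF that] .
  show "locally_finite ((\<lambda>y. y + v) ` Z p)" if "p \<in> space P" for p
    using measurable_space[OF Z that] bd by (simp add: space_config_space locally_finite_def vim)
  fix A :: "'a set" assume A: "A \<in> sets borel" "bounded A"
  have "(\<lambda>y. y - v) ` A = (\<lambda>y. y + v) -` A" by (force simp: image_iff)
  then have "(\<lambda>y. y - v) ` A \<in> sets borel"
    using measurable_sets_borel[OF _ A(1), of "\<lambda>y. y + v"] by simp
  from measurable_config_card[OF this bd[OF A(2)] Z]
  show "(\<lambda>p. card ((\<lambda>y. y + v) ` Z p \<inter> A)) \<in> measurable P (count_space UNIV)"
    by (simp add: vim card_image)
qed

lemma pip_intensity_translate:
  fixes \<phi> :: "'a::euclidean_space \<Rightarrow> real"
  assumes "finite_range \<phi>" "locally_finite \<xi>"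
  shows "pip_intensity \<beta> \<phi> (x + v) ((\<lambda>y. y + v) ` \<xi>) = pip_intensity \<beta> \<phi> x \<xi>"
proof -
  let ?S = "{y\<in>\<xi>. \<phi> (x - y) \<noteq> 1}"
  have f: "finite ?S" by (rule finite_range_finite[OF assms])
  have "pip_intensity \<beta> \<phi> x \<xi> = \<beta> * (\<Prod>y\<in>?S. \<phi> (x - y))"
    by (rule pip_intensity_finite[OF f]) auto
  moreover have "pip_intensity \<beta> \<phi> (x + v) ((\<lambda>y. y + v) ` \<xi>) = \<beta> * (\<Prod>y\<in>(\<lambda>y. y + v) ` ?S. \<phi> (x + v - y))"
    using f by (intro pip_intensity_finite) auto
  ultimately show ?thesis by (simp add: prod.reindex)
qed

lemma PIP_intensity:
  fixes \<Xi> :: "'w \<Rightarrow> 'a::euclidean_space set"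
  assumes pip: "PIP M \<Xi> \<beta> \<phi>" and fr: "finite_range \<phi>" and inh: "inhibitory \<phi>"
    and A: "A \<in> sets borel"
  shows "(\<integral>\<^sup>+\<omega>. emeasure (count_space UNIV) (\<Xi> \<omega> \<inter> A) \<partial>M)
    = ennreal (intensity M \<Xi> (pip_intensity \<beta> \<phi>)) * emeasure lborel A"
proof -
  let ?ci = "pip_intensity \<beta> \<phi>"
  note [measurable] = A
  have gibbs: "gibbs_process M \<Xi> ?ci" and stat: "stationary M \<Xi>" and \<phi>0: "\<And>x. 0 \<le> \<phi> x" and \<beta>: "0 < \<beta>"
    using pip by (auto simp: PIP_def)
  interpret prob_space M using gibbs by (simp add: gibbs_process_def point_process_def)
  have \<Xi>[measurable]: "\<Xi> \<in> measurable M config_space"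
    and ci[measurable]: "(\<lambda>z. ?ci (fst z) (snd z)) \<in> borel_measurable (borel \<Otimes>\<^sub>M config_space)"
    using gibbs by (auto simp: gibbs_process_def point_process_def case_prod_beta')
  have ci1[measurable]: "?ci x \<in> borel_measurable config_space" for x
    using measurable_compose[OF measurable_Pair1'[of x borel config_space] ci] by simp
  have lf: "locally_finite (\<Xi> \<omega>)" if "\<omega> \<in> space M" for \<omega>
    using measurable_space[OF \<Xi> that] by (simp add: space_config_space)
  have bnd: "0 \<le> ?ci x (\<Xi> \<omega>)" "?ci x (\<Xi> \<omega>) \<le> \<beta>" if "\<omega> \<in> space M" for x \<omega>
    using pip_intensity_bounds[OF fr lf[OF that] \<phi>0 inh, of \<beta> x] \<beta> by auto
  have const: "(\<integral>\<^sup>+\<omega>. ennreal (?ci x (\<Xi> \<omega>)) \<partial>M) = ennreal (intensity M \<Xi> ?ci)" for x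
  proof -
    note [measurable] = config_translate_measurable[OF \<Xi>]
    have "(\<integral>\<omega>. ?ci x (\<Xi> \<omega>) \<partial>M) = (\<integral>\<xi>. ?ci x \<xi> \<partial>distr M config_space \<Xi>)"
      by (subst integral_distr) auto
    also have "\<dots> = (\<integral>\<xi>. ?ci x \<xi> \<partial>distr M config_space (\<lambda>\<omega>. (\<lambda>y. y + x) ` \<Xi> \<omega>))"
      using stat unfolding stationary_def by simp
    also have "\<dots> = (\<integral>\<omega>. ?ci x ((\<lambda>y. y + x) ` \<Xi> \<omega>) \<partial>M)"
      by (subst integral_distr) auto
    also have "\<dots> = (\<integral>\<omega>. ?ci 0 (\<Xi> \<omega>) \<partial>M)"
      using pip_intensity_translate[OF fr lf, of _ \<beta> 0 x] by (intro Bochner_Integration.integral_cong) auto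
    finally have "(\<integral>\<omega>. ?ci x (\<Xi> \<omega>) \<partial>M) = intensity M \<Xi> ?ci" by (simp add: intensity_def)
    moreover have "integrable M (\<lambda>\<omega>. ?ci x (\<Xi> \<omega>))"
      using bnd by (intro integrable_const_bound[of _ \<beta>]) auto
    ultimately show ?thesis using bnd by (subst nn_integral_eq_integral) auto
  qed
  have "(\<integral>\<^sup>+\<omega>. emeasure (count_space UNIV) (\<Xi> \<omega> \<inter> A) \<partial>M)
      = (\<integral>\<^sup>+\<omega>. (\<integral>\<^sup>+x. indicator A x \<partial>count_space (\<Xi> \<omega>)) \<partial>M)"
    by (intro nn_integral_cong, simp add: nn_integral_count_space_indicator flip: nn_integral_indicator)
      (intro nn_integral_cong, auto simp: indicator_def)
  also have "\<dots> = (\<integral>\<^sup>+x. (\<integral>\<^sup>+\<omega>. indicator A x * ennreal (?ci x (\<Xi> \<omega>)) \<partial>M) \<partial>lborel)"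
    using gibbs_process_ennreal[OF gibbs, of "\<lambda>z. indicator A (fst z)"] by simp
  also have "\<dots> = (\<integral>\<^sup>+x. indicator A x * ennreal (intensity M \<Xi> ?ci) \<partial>lborel)"
    by (simp add: nn_integral_cmult const)
  also have "\<dots> = ennreal (intensity M \<Xi> ?ci) * emeasure lborel A"
    by (simp add: nn_integral_multc mult.commute)
  finally show ?thesis .
qed

lemma PIP_correlation2:
  fixes \<Xi> :: "'w \<Rightarrow> 'a::euclidean_space set"
  assumes pip: "PIP M \<Xi> \<beta> \<phi>" and fr: "finite_range \<phi>" and inh: "inhibitory \<phi>"
  shows "is_second_correlation M \<Xi> (pip_correlation2 M \<Xi> \<beta> \<phi>)"
proof -
  let ?ci = "pip_intensity \<beta> \<phi>"
  have gibbs: "gibbs_process M \<Xi> ?ci" and \<phi>0: "\<And>x. 0 \<le> \<phi> x" and \<beta>: "0 < \<beta>"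
    and \<phi>m[measurable]: "\<phi> \<in> borel_measurable borel" and sym: "\<And>x. \<phi> (- x) = \<phi> x"
    using pip by (auto simp: PIP_def)
  interpret prob_space M using gibbs by (simp add: gibbs_process_def point_process_def)
  interpret LM: pair_sigma_finite lborel M by unfold_locales
  have \<Xi>[measurable]: "\<Xi> \<in> measurable M config_space"
    and ci: "(\<lambda>z. ?ci (fst z) (snd z)) \<in> borel_measurable (borel \<Otimes>\<^sub>M config_space)"
    using gibbs by (auto simp: gibbs_process_def point_process_def case_prod_beta')
  have ci'[measurable]: "(\<lambda>p. ?ci (f p) (Z p)) \<in> borel_measurable P"
    if "f \<in> borel_measurable P" "Z \<in> measurable P config_space" for f Z and P :: "'p measure"
    using measurable_compose[OF measurable_Pair[OF that] ci] by simp
  have lf: "locally_finite (\<Xi> \<omega>)" if "\<omega> \<in> space M" for \<omega>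
    using measurable_space[OF \<Xi> that] by (simp add: space_config_space)
  have bnd: "0 \<le> ?ci x (\<Xi> \<omega>)" "?ci x (\<Xi> \<omega>) \<le> \<beta>" if "\<omega> \<in> space M" for x \<omega>
    using pip_intensity_bounds[OF fr lf[OF that] \<phi>0 inh, of \<beta> x] \<beta> by auto
  have corr: "pip_correlation2 M \<Xi> \<beta> \<phi> x y = \<phi> (x - y) * (\<integral>\<omega>. ?ci x (\<Xi> \<omega>) * ?ci y (\<Xi> \<omega>) \<partial>M)" for x y
  proof -
    have "(\<integral>\<omega>. ?ci x (\<Xi> \<omega>) * ?ci y (\<Xi> \<omega>) \<partial>M)
        = (\<integral>\<omega>. \<beta>\<^sup>2 * config_prod (\<lambda>z. \<phi> (z - x) * \<phi> (z - y)) (\<Xi> \<omega>) \<partial>M)"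
      by (intro Bochner_Integration.integral_cong refl pip_intensity_mult[OF fr lf sym])
    then show ?thesis by (simp add: pip_correlation2_def)
  qed
  have corr_nn: "ennreal (pip_correlation2 M \<Xi> \<beta> \<phi> x y)
      = (\<integral>\<^sup>+\<omega>. ennreal (\<phi> (x - y) * ?ci x (\<Xi> \<omega>) * ?ci y (\<Xi> \<omega>)) \<partial>M)" for x y
  proof -
    have "integrable M (\<lambda>\<omega>. ?ci x (\<Xi> \<omega>) * ?ci y (\<Xi> \<omega>))"
      using bnd by (intro integrable_const_bound[of _ "\<beta> * \<beta>"]) (auto intro!: mult_mono AE_I2 simp: abs_mult less_imp_le[OF \<beta>])
    then have "integrable M (\<lambda>\<omega>. \<phi> (x - y) * ?ci x (\<Xi> \<omega>) * ?ci y (\<Xi> \<omega>))"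
      by (simp add: mult.assoc)
    then show ?thesis using bnd \<phi>0
      by (subst nn_integral_eq_integral) (auto simp: corr mult.assoc)
  qed
  have corr0: "0 \<le> pip_correlation2 M \<Xi> \<beta> \<phi> x y" for x y
    unfolding corr using bnd \<phi>0 by (intro mult_nonneg_nonneg integral_nonneg_AE) auto
  have corrm: "(\<lambda>(x, y). pip_correlation2 M \<Xi> \<beta> \<phi> x y) \<in> borel_measurable (borel \<Otimes>\<^sub>M borel)"
    unfolding corr case_prod_beta' by measurable
  have null: "AE y in lborel. AE \<omega> in M. y \<notin> \<Xi> \<omega>"
  proof -
    have m: "(\<lambda>p. indicator (\<Xi> (snd p)) (fst p) :: ennreal) \<in> borel_measurable (lborel \<Otimes>\<^sub>M M)"
      by (rule config_member_measurable) measurable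
    have "(\<integral>\<^sup>+y. (\<integral>\<^sup>+\<omega>. indicator (\<Xi> \<omega>) y \<partial>M) \<partial>lborel) = (\<integral>\<^sup>+\<omega>. (\<integral>\<^sup>+y. indicator (\<Xi> \<omega>) y \<partial>lborel) \<partial>M)"
      using LM.Fubini'[of "\<lambda>y \<omega>. indicator (\<Xi> \<omega>) y"] m by (simp add: case_prod_beta')
    also have "\<dots> = (\<integral>\<^sup>+\<omega>. 0 \<partial>M)"
    proof (intro nn_integral_cong)
      fix \<omega> assume "\<omega> \<in> space M"
      then have "countable (\<Xi> \<omega>)" using lf locally_finite_countable by blast
      then have "\<Xi> \<omega> \<in> null_sets lborel" by (rule countable_imp_null_set_lborel)
      then have "emeasure lborel (\<Xi> \<omega>) = 0" "\<Xi> \<omega> \<in> sets borel" by auto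
      then show "(\<integral>\<^sup>+y. indicator (\<Xi> \<omega>) y \<partial>lborel) = (0::ennreal)" by simp
    qed
    finally have "AE y in lborel. (\<integral>\<^sup>+\<omega>. (indicator (\<Xi> \<omega>) y :: ennreal) \<partial>M) = 0"
      using borel_measurable_nn_integral[of "\<lambda>y \<omega>. indicator (\<Xi> \<omega>) y" lborel] m
      by (subst nn_integral_0_iff_AE[symmetric]) (auto simp: case_prod_beta')
    then show ?thesis
    proof eventually_elim
      case (elim y)
      then have "AE \<omega> in M. (indicator (\<Xi> \<omega>) y :: ennreal) = 0"
        using config_member_measurable[OF \<Xi>, of "\<lambda>_. y"] by (subst (asm) nn_integral_0_iff_AE) auto
      then show "AE \<omega> in M. y \<notin> \<Xi> \<omega>" by eventually_elim (auto simp: indicator_def split: if_splits)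
    qed
  qed
  have "factorial_moment2 M \<Xi> A =
      (\<integral>\<^sup>+(x, y). ennreal (pip_correlation2 M \<Xi> \<beta> \<phi> x y) * indicator A (x, y) \<partial>(lborel \<Otimes>\<^sub>M lborel))"
    if A[measurable]: "A \<in> sets (borel \<Otimes>\<^sub>M borel)" for A :: "('a \<times> 'a) set"
  proof -
    have [measurable]: "A \<in> sets borel" using A unfolding borel_prod .
    have hm: "(\<lambda>z. \<integral>\<^sup>+y. indicator A (fst z, y) \<partial>count_space (snd z)) \<in> borel_measurable (borel \<Otimes>\<^sub>M config_space)"
    proof (rule config_integral_measurable)
      show "(\<lambda>(z, y). indicator A (fst z, y) :: ennreal)
          \<in> borel_measurable ((borel \<Otimes>\<^sub>M config_space) \<Otimes>\<^sub>M borel)"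
        unfolding case_prod_beta' by measurable
    qed measurable
    have gm: "(\<lambda>z. indicator A (x, fst z) * ennreal (?ci x (insert (fst z) (snd z))))
        \<in> borel_measurable (borel \<Otimes>\<^sub>M config_space)" for x
    proof -
      have "(\<lambda>z. insert (fst z) (snd z)) \<in> measurable (borel \<Otimes>\<^sub>M config_space) config_space"
        by (rule config_insert_measurable) measurable
      then show ?thesis by measurable
    qed
    have "factorial_moment2 M \<Xi> A
        = (\<integral>\<^sup>+\<omega>. (\<integral>\<^sup>+x. (\<integral>\<^sup>+y. indicator A (x, y) \<partial>count_space (\<Xi> \<omega> - {x})) \<partial>count_space (\<Xi> \<omega>)) \<partial>M)"
      unfolding factorial_moment2_def
    proof (intro nn_integral_cong)
      fix \<omega>
      let ?D = "{(x, y). x \<in> \<Xi> \<omega> \<and> y \<in> \<Xi> \<omega> \<and> x \<noteq> y}"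
      have "(\<integral>\<^sup>+p. (indicator A p :: ennreal) \<partial>count_space ?D)
          = (\<integral>\<^sup>+p. indicator A p * indicator ?D p \<partial>count_space UNIV)"
        by (simp add: nn_integral_count_space_indicator)
      also have "\<dots> = (\<integral>\<^sup>+x. \<integral>\<^sup>+y. indicator A (x, y) * indicator ?D (x, y) \<partial>count_space UNIV \<partial>count_space UNIV)"
        by (rule nn_integral_fst_count_space[symmetric])
      also have "\<dots> = (\<integral>\<^sup>+x. (\<integral>\<^sup>+y. indicator A (x, y) * indicator (\<Xi> \<omega> - {x}) y \<partial>count_space UNIV) * indicator (\<Xi> \<omega>) x \<partial>count_space UNIV)"
      proof (intro nn_integral_cong)
        fix x
        show "(\<integral>\<^sup>+y. (indicator A (x, y) :: ennreal) * indicator ?D (x, y) \<partial>count_space UNIV)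
          = (\<integral>\<^sup>+y. indicator A (x, y) * indicator (\<Xi> \<omega> - {x}) y \<partial>count_space UNIV) * indicator (\<Xi> \<omega>) x"
        proof (cases "x \<in> \<Xi> \<omega>")
          case True
          have "(indicator ?D (x, y) :: ennreal) = indicator (\<Xi> \<omega> - {x}) y" for y
            using True by (auto simp: indicator_def)
          then show ?thesis using True by simp
        qed (simp add: indicator_def)
      qed
      finally show "(\<integral>\<^sup>+p. (indicator A p :: ennreal) \<partial>count_space ?D)
          = (\<integral>\<^sup>+x. (\<integral>\<^sup>+y. indicator A (x, y) \<partial>count_space (\<Xi> \<omega> - {x})) \<partial>count_space (\<Xi> \<omega>))"
        by (simp add: nn_integral_count_space_indicator)
    qed
    also have "\<dots> = (\<integral>\<^sup>+x. (\<integral>\<^sup>+\<omega>. (\<integral>\<^sup>+y. indicator A (x, y) \<partial>count_space (\<Xi> \<omega>)) * ennreal (?ci x (\<Xi> \<omega>)) \<partial>M) \<partial>lborel)"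
      using gibbs_process_ennreal[OF gibbs hm] by simp
    also have "\<dots> = (\<integral>\<^sup>+x. (\<integral>\<^sup>+\<omega>. (\<integral>\<^sup>+y. indicator A (x, y) * ennreal (?ci x (insert y (\<Xi> \<omega> - {y}))) \<partial>count_space (\<Xi> \<omega>)) \<partial>M) \<partial>lborel)"
      by (intro nn_integral_cong, subst nn_integral_multc[symmetric], simp)
        (intro nn_integral_cong, simp add: insert_absorb)
    also have "\<dots> = (\<integral>\<^sup>+x. (\<integral>\<^sup>+y. (\<integral>\<^sup>+\<omega>. indicator A (x, y) * ennreal (?ci x (insert y (\<Xi> \<omega>))) * ennreal (?ci y (\<Xi> \<omega>)) \<partial>M) \<partial>lborel) \<partial>lborel)"
      using gibbs_process_ennreal[OF gibbs gm] by simp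
    also have "\<dots> = (\<integral>\<^sup>+x. (\<integral>\<^sup>+y. ennreal (pip_correlation2 M \<Xi> \<beta> \<phi> x y) * indicator A (x, y) \<partial>lborel) \<partial>lborel)"
    proof (rule nn_integral_cong, rule nn_integral_cong_AE, use null in eventually_elim)
      case (elim x y)
      have "(\<integral>\<^sup>+\<omega>. indicator A (x, y) * ennreal (?ci x (insert y (\<Xi> \<omega>))) * ennreal (?ci y (\<Xi> \<omega>)) \<partial>M)
          = (\<integral>\<^sup>+\<omega>. ennreal (\<phi> (x - y) * ?ci x (\<Xi> \<omega>) * ?ci y (\<Xi> \<omega>)) * indicator A (x, y) \<partial>M)"
      proof (rule nn_integral_cong_AE, rule AE_mp[OF elim(2)], intro AE_I2 impI)
        fix \<omega> assume \<omega>: "\<omega> \<in> space M" "y \<notin> \<Xi> \<omega>"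
        show "indicator A (x, y) * ennreal (?ci x (insert y (\<Xi> \<omega>))) * ennreal (?ci y (\<Xi> \<omega>))
          = ennreal (\<phi> (x - y) * ?ci x (\<Xi> \<omega>) * ?ci y (\<Xi> \<omega>)) * indicator A (x, y)"
          using bnd[OF \<omega>(1)] \<phi>0 by (simp add: pip_intensity_insert[OF fr lf[OF \<omega>(1)] \<omega>(2)] ennreal_mult mult_ac)
      qed
      also have "\<dots> = ennreal (pip_correlation2 M \<Xi> \<beta> \<phi> x y) * indicator A (x, y)"
        unfolding corr_nn by (rule nn_integral_multc) measurable
      finally show ?case .
    qed
    also have "\<dots> = (\<integral>\<^sup>+(x, y). ennreal (pip_correlation2 M \<Xi> \<beta> \<phi> x y) * indicator A (x, y) \<partial>(lborel \<Otimes>\<^sub>M lborel))"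
    proof -
      have "(\<lambda>(x, y). ennreal (pip_correlation2 M \<Xi> \<beta> \<phi> x y) * indicator A (x, y)) \<in> borel_measurable (lborel \<Otimes>\<^sub>M lborel)"
        using corrm unfolding case_prod_beta' by measurable
      from lborel.nn_integral_fst[OF this] show ?thesis by simp
    qed
    finally show ?thesis .
  qed
  then show ?thesis using corr0 corrm by (auto simp: is_second_correlation_def)
qed

end

theory Submission
  imports Defs "HOL-Real_Asymp.Real_Asymp"
begin

text \<open>
  Up to the factor \<open>\<beta>\<^sup>2 * \<phi> x / lam\<^sup>2\<close>, the pair correlation function at \<open>norm x\<close> is the
  expectation of \<open>\<Prod>y\<in>\<Xi>. (1 - u y)\<close> with \<open>u y = 1 - \<phi> y * \<phi> (y - x)\<close>. If every point \<open>y\<close> is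
  retained independently with probability \<open>u y\<close>, this expectation is the probability that no
  point is retained. Write \<open>G = \<integral>u\<close>, which is \<open>G_tilde \<phi> x\<close>. Both bounds on the pair correlation
  then follow from
  \<open>1 - lam * G \<le> E (\<Prod>y\<in>\<Xi>. (1 - u y)) \<le> 1 - lam / \<beta> * (1 - exp (- \<beta> * G))\<close>
  (\<open>void_probability_ge\<close>, \<open>void_probability_le\<close>), which holds for every Gibbs process whose
  conditional intensity is bounded by \<open>\<beta>\<close>, decreasing in the configuration and of constant
  mean \<open>lam\<close>.

  The lower bound is the union bound. For the upper bound let \<open>\<Psi> s\<close> be the void
  probability for the retention function \<open>s * u\<close>. The Gibbs identity gives
  \<open>- \<Psi>' s = \<integral>u x * E (ci x \<Xi> * \<Prod>y\<in>\<Xi>. (1 - s * u y)) dx\<close>. The expectation inside is \<open>lam\<close> times a void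
  probability of the reduced Palm process at \<open>x\<close>, which is again a Gibbs process with conditional
  intensity at most \<open>\<beta>\<close>. Such a process has stochastically fewer points than a Poisson process
  of intensity \<open>\<beta>\<close>, so the expectation is at least \<open>lam * exp (- \<beta> * s * G)\<close>
  (\<open>void_prod_weighted_ge\<close>, itself a differential inequality in \<open>s\<close>), and integration over
  \<open>s \<in> [0, 1]\<close> yields the bound.

  The derivatives are avoided. As \<open>\<Prod>y\<in>\<Xi>. (1 - s * u y)\<close> is convex in \<open>s\<close>, its increments lie
  between tangent slopes (\<open>void_prod_step\<close>), so both differential inequalities can be replaced by
  difference inequalities over the grid \<open>k / n\<close>, followed by \<open>n \<rightarrow> \<infinity>\<close>.

  Stationarity and isotropy make the correlation function depend on the distance only
  (\<open>pip_correlation2_radial\<close>); in dimension one, where the only rotation is the identity, exchanging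
  the two points takes the place of rotations. The bounds on the \<open>K\<close> function follow since all
  integrands are measurable and bounded.
\<close>

section \<open>Finite products\<close>

lemma sum_prod_remove_insert:
  fixes d p :: "'b \<Rightarrow> 'c::comm_semiring_1"
  assumes "finite S" "j \<notin> S"
  shows "(\<Sum>i\<in>insert j S. d i * prod p (insert j S - {i}))
    = d j * prod p S + p j * (\<Sum>i\<in>S. d i * prod p (S - {i}))"
proof -
  have "(\<Sum>i\<in>S. d i * prod p (insert j S - {i})) = (\<Sum>i\<in>S. p j * (d i * prod p (S - {i})))"
  proof (rule sum.cong)
    fix i assume "i \<in> S"
    then have "insert j S - {i} = insert j (S - {i})" using assms by auto
    then show "d i * prod p (insert j S - {i}) = p j * (d i * prod p (S - {i}))"
      using assms by (simp add: mult_ac)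
  qed simp
  moreover have "insert j S - {j} = S" using assms by auto
  ultimately show ?thesis using assms by (simp add: sum_distrib_left)
qed

text \<open>The product along the segment from \<open>q\<close> to \<open>p\<close> is a convex function of the position on the
  segment, because its Taylor coefficients at \<open>q\<close> are nonnegative. It therefore lies above its
  tangents; the next two lemmas use the tangent at \<open>p\<close> and the one at \<open>q\<close>.\<close>

lemma prod_tangent_upper:
  fixes p q :: "'b \<Rightarrow> real"
  assumes "finite S" "\<And>i. i \<in> S \<Longrightarrow> 0 \<le> q i \<and> q i \<le> p i"
  shows "prod p S \<le> prod q S + (\<Sum>i\<in>S. (p i - q i) * prod p (S - {i}))"
  using assms
proof (induction S rule: finite_induct)
  case (insert j S)
  let ?T = "\<Sum>i\<in>S. (p i - q i) * prod p (S - {i})"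
  have pq: "0 \<le> q j" "q j \<le> p j" using insert.prems by auto
  have "0 \<le> ?T"
    using insert.prems by (intro sum_nonneg mult_nonneg_nonneg prod_nonneg) (auto intro: order_trans)
  then have "q j * ?T \<le> p j * ?T" using pq by (simp add: mult_right_mono)
  moreover have "q j * prod p S \<le> q j * (prod q S + ?T)"
    using insert pq by (intro mult_left_mono) auto
  ultimately show ?case
    using insert.hyps by (simp only: sum_prod_remove_insert[OF insert.hyps(1,2)]) (simp add: algebra_simps)
qed simp

lemma prod_tangent_lower:
  fixes p q :: "'b \<Rightarrow> real"
  assumes "finite S" "\<And>i. i \<in> S \<Longrightarrow> 0 \<le> q i \<and> q i \<le> p i"
  shows "prod q S + (\<Sum>i\<in>S. (p i - q i) * prod q (S - {i})) \<le> prod p S"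
  using assms
proof (induction S rule: finite_induct)
  case (insert j S)
  let ?T = "\<Sum>i\<in>S. (p i - q i) * prod q (S - {i})"
  have pq: "0 \<le> q j" "q j \<le> p j" "0 \<le> p j" using insert.prems[of j] by auto
  have "0 \<le> ?T"
    using insert.prems by (intro sum_nonneg mult_nonneg_nonneg prod_nonneg) (auto intro: order_trans)
  then have "q j * ?T \<le> p j * ?T" using pq by (simp add: mult_right_mono)
  moreover have "p j * (prod q S + ?T) \<le> p j * prod p S"
    using insert pq by (intro mult_left_mono) auto
  ultimately show ?case
    using insert.hyps by (simp only: sum_prod_remove_insert[OF insert.hyps(1,2)]) (simp add: algebra_simps)
qed simp

section \<open>Thinning products over configurations\<close>

text \<open>A function \<open>u\<close> with this property is thought of as the probability of retaining a point in
  an independent thinning; \<open>void_prod u \<xi>\<close> is then the conditional probability that no point of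
  \<open>\<xi>\<close> is retained. Bounded support leaves finitely many factors different from 1.\<close>

definition retention :: "('a::euclidean_space \<Rightarrow> real) \<Rightarrow> bool" where
  "retention u \<longleftrightarrow> u \<in> borel_measurable borel \<and> (\<forall>x. 0 \<le> u x \<and> u x \<le> 1) \<and> bounded {x. u x \<noteq> 0}"

definition void_prod :: "('a::euclidean_space \<Rightarrow> real) \<Rightarrow> 'a set \<Rightarrow> real" where
  "void_prod u \<xi> = config_prod (\<lambda>y. 1 - u y) \<xi>"

lemma retentionD:
  assumes "retention u"
  shows "u \<in> borel_measurable borel" "0 \<le> u x" "u x \<le> 1" "bounded {x. u x \<noteq> 0}"
  using assms by (auto simp: retention_def)

lemma retention_scale:
  assumes "retention u" "0 \<le> s" "s \<le> 1"
  shows "retention (\<lambda>x. s * u x)"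
proof -
  have "bounded {x. s * u x \<noteq> 0}"
    by (rule bounded_subset[OF retentionD(4)[OF assms(1)]]) auto
  then show ?thesis
    using assms retentionD[OF assms(1)] by (auto simp: retention_def intro: mult_le_one)
qed

lemma retention_finite:
  assumes "retention u" "locally_finite \<xi>"
  shows "finite {z\<in>\<xi>. u z \<noteq> 0}"
proof -
  have "{z\<in>\<xi>. u z \<noteq> 0} = \<xi> \<inter> {x. u x \<noteq> 0}" by auto
  then show ?thesis using assms retentionD(4)[OF assms(1)] by (simp add: locally_finite_def)
qed

lemma retention_integrable:
  fixes u :: "'a::euclidean_space \<Rightarrow> real"
  assumes "retention u"
  shows "integrable lborel u"
proof -
  note [measurable] = retentionD(1)[OF assms]
  obtain r where r: "{x. u x \<noteq> 0} \<subseteq> cball 0 r"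
    using retentionD(4)[OF assms] by (auto simp: bounded_iff subset_iff)
  have i: "integrable lborel (\<lambda>x. indicator (cball (0::'a) r) x :: real)"
    using emeasure_lborel_cball_finite[of "0::'a" r] by (intro integrable_real_indicator) auto
  have "norm (u x) \<le> norm (indicator (cball (0::'a) r) x :: real)" for x
    using r retentionD(2,3)[OF assms, of x] by (cases "x \<in> cball 0 r") (auto simp: subset_iff)
  then show ?thesis by (intro Bochner_Integration.integrable_bound[OF i]) auto
qed

lemma void_prod_finite:
  assumes "finite S" "S \<subseteq> \<xi>" "{z\<in>\<xi>. u z \<noteq> 0} \<subseteq> S"
  shows "void_prod u \<xi> = (\<Prod>y\<in>S. 1 - u y)"
  unfolding void_prod_def using assms by (subst config_prod_finite[of S]) auto

lemma void_prod_bounds: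
  assumes "retention u" "locally_finite \<xi>"
  shows "0 \<le> void_prod u \<xi>" "void_prod u \<xi> \<le> 1"
proof -
  have "void_prod u \<xi> = (\<Prod>y\<in>{z\<in>\<xi>. u z \<noteq> 0}. 1 - u y)"
    by (rule void_prod_finite[OF retention_finite[OF assms]]) auto
  then show "0 \<le> void_prod u \<xi>" "void_prod u \<xi> \<le> 1"
    using retentionD[OF assms(1)] by (auto intro!: prod_nonneg prod_le_1)
qed

lemma void_prod_zero: "void_prod (\<lambda>x. 0) \<xi> = 1"
  by (subst void_prod_finite[of "{}"]) auto

text \<open>Sums over a configuration are measurable, and a product is the exponential of a sum of
  logarithms; vanishing factors are detected by counting them.\<close>

lemma void_prod_measurable:
  assumes u: "retention u"
  shows "void_prod u \<in> borel_measurable config_space"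
proof -
  note [measurable] = retentionD(1)[OF u]
  let ?N = "\<lambda>\<xi>. \<integral>\<^sup>+x. indicator {1} (u x) \<partial>count_space \<xi>"
  let ?I = "\<lambda>\<xi>. \<integral>\<^sup>+x. ennreal (- ln (1 - u x)) \<partial>count_space \<xi>"
  have "void_prod u \<xi> = (if ?N \<xi> = 0 then exp (- enn2real (?I \<xi>)) else 0)"
    if "locally_finite \<xi>" for \<xi>
  proof -
    let ?S = "{z\<in>\<xi>. u z \<noteq> 0}"
    have f: "finite ?S" by (rule retention_finite[OF u that])
    have V: "void_prod u \<xi> = (\<Prod>y\<in>?S. 1 - u y)" by (rule void_prod_finite[OF f]) auto
    have N: "?N \<xi> = (\<Sum>z\<in>?S. indicator {1} (u z))"
      using f by (intro nn_integral_count_space') auto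
    have I: "?I \<xi> = (\<Sum>z\<in>?S. ennreal (- ln (1 - u z)))"
      using f by (intro nn_integral_count_space') auto
    show ?thesis
    proof (cases "\<exists>z\<in>?S. u z = 1")
      case True
      then have "void_prod u \<xi> = 0" using f unfolding V by (auto intro!: prod_zero)
      moreover have "?N \<xi> \<noteq> 0" using True f unfolding N by (auto simp: sum_eq_0_iff)
      ultimately show ?thesis by simp
    next
      case False
      then have lt: "u z < 1" if "z \<in> ?S" for z
        using that retentionD(3)[OF u, of z] by (auto simp: less_le)
      have "?N \<xi> = 0" using False unfolding N by (intro sum.neutral) (auto simp: indicator_def)
      moreover have "?I \<xi> = ennreal (\<Sum>z\<in>?S. - ln (1 - u z))"
        unfolding I using lt retentionD(2)[OF u] by (intro sum_ennreal) auto
      moreover have "0 \<le> (\<Sum>z\<in>?S. - ln (1 - u z))"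
        using lt retentionD(2)[OF u] by (intro sum_nonneg) auto
      moreover have "(\<Prod>y\<in>?S. 1 - u y) = exp (\<Sum>z\<in>?S. ln (1 - u z))"
        using f lt by (auto simp: exp_sum intro!: prod.cong)
      ultimately show ?thesis unfolding V by (simp add: sum_negf)
    qed
  qed
  moreover have [measurable]: "?N \<in> borel_measurable config_space" "?I \<in> borel_measurable config_space"
    by (rule config_integral_measurable; measurable)+
  ultimately show ?thesis
    by (subst measurable_cong[of config_space _ "\<lambda>\<xi>. if ?N \<xi> = 0 then exp (- enn2real (?I \<xi>)) else 0"])
      (auto simp: space_config_space)
qed

text \<open>The reduced configurations \<open>\<xi> - {z}\<close> bring the increments of the void probability into the
  form to which the Gibbs identity applies.\<close>

lemma void_prod_step:
  assumes v: "retention v" and w: "retention w" and vw: "\<And>x. v x \<le> w x" and \<xi>: "locally_finite \<xi>"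
  shows void_prod_step_upper: "ennreal (void_prod v \<xi>) \<le> ennreal (void_prod w \<xi>)
      + (\<integral>\<^sup>+z. ennreal (w z - v z) * ennreal (void_prod v (\<xi> - {z})) \<partial>count_space \<xi>)" (is ?A)
    and void_prod_step_lower: "ennreal (void_prod w \<xi>)
      + (\<integral>\<^sup>+z. ennreal (w z - v z) * ennreal (void_prod w (\<xi> - {z})) \<partial>count_space \<xi>)
      \<le> ennreal (void_prod v \<xi>)" (is ?B)
proof -
  let ?S = "{z\<in>\<xi>. v z \<noteq> 0} \<union> {z\<in>\<xi>. w z \<noteq> 0}"
  have f: "finite ?S" using retention_finite[OF v \<xi>] retention_finite[OF w \<xi>] by simp
  have V: "void_prod v \<xi> = (\<Prod>y\<in>?S. 1 - v y)" "void_prod w \<xi> = (\<Prod>y\<in>?S. 1 - w y)"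
    by (rule void_prod_finite[OF f]; auto)+
  have V': "void_prod v (\<xi> - {z}) = (\<Prod>y\<in>?S - {z}. 1 - v y)"
    "void_prod w (\<xi> - {z}) = (\<Prod>y\<in>?S - {z}. 1 - w y)" for z
    using f by (intro void_prod_finite; auto)+
  have 01: "0 \<le> 1 - w i \<and> 1 - w i \<le> 1 - v i" "0 \<le> 1 - v i" for i
    using retentionD(3)[OF w, of i] vw[of i] by auto
  have I: "(\<integral>\<^sup>+z. ennreal (w z - v z) * ennreal (g z) \<partial>count_space \<xi>) = ennreal (\<Sum>z\<in>?S. (w z - v z) * g z)"
    if "\<And>z. 0 \<le> g z" for g
  proof -
    have "(\<integral>\<^sup>+z. ennreal (w z - v z) * ennreal (g z) \<partial>count_space \<xi>)
        = (\<Sum>z\<in>?S. ennreal (w z - v z) * ennreal (g z))"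
      using f by (intro nn_integral_count_space') auto
    also have "\<dots> = (\<Sum>z\<in>?S. ennreal ((w z - v z) * g z))"
      using that vw by (simp add: ennreal_mult)
    also have "\<dots> = ennreal (\<Sum>z\<in>?S. (w z - v z) * g z)"
      using that vw by (intro sum_ennreal) simp
    finally show ?thesis .
  qed
  have P: "0 \<le> (\<Prod>y\<in>T. 1 - v y)" "0 \<le> (\<Prod>y\<in>T. 1 - w y)" for T using 01 by (auto intro!: prod_nonneg)
  have sum0: "0 \<le> (\<Sum>z\<in>?S. (w z - v z) * g z)" if "\<And>z. 0 \<le> g z" for g
    using that vw by (intro sum_nonneg) simp
  show ?A
    unfolding V V' I[OF P(1)] using prod_tangent_upper[OF f, of "\<lambda>y. 1 - w y" "\<lambda>y. 1 - v y"] 01 P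
    by (subst ennreal_plus[symmetric]) (auto intro!: sum0 ennreal_leI)
  show ?B
    unfolding V V' I[OF P(2)] using prod_tangent_lower[OF f, of "\<lambda>y. 1 - w y" "\<lambda>y. 1 - v y"] 01 P
    by (subst ennreal_plus[symmetric]) (auto intro!: sum0 ennreal_leI)
qed


section \<open>Void probabilities of repulsive Gibbs processes\<close>

locale repulsive_gibbs =
  fixes M :: "'w measure" and \<Xi> :: "'w \<Rightarrow> 'a::euclidean_space set"
    and ci :: "'a \<Rightarrow> 'a set \<Rightarrow> real" and \<beta> :: real
  assumes gibbs: "gibbs_process M \<Xi> ci"
    and ci_le: "\<And>x \<xi>. locally_finite \<xi> \<Longrightarrow> ci x \<xi> \<le> \<beta>"
    and ci_insert: "\<And>x z \<xi>. locally_finite \<xi> \<Longrightarrow> ci x (insert z \<xi>) \<le> ci x \<xi>"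
    and \<beta>_pos: "0 < \<beta>"
begin

sublocale prob_space M
  using gibbs by (simp add: gibbs_process_def point_process_def)

lemma \<Xi>_measurable[measurable]: "\<Xi> \<in> measurable M config_space"
  using gibbs by (simp add: gibbs_process_def point_process_def)

lemma ci_measurable[measurable]:
  "(\<lambda>z. ci (fst z) (snd z)) \<in> borel_measurable (borel \<Otimes>\<^sub>M config_space)"
  using gibbs by (simp add: gibbs_process_def case_prod_beta')

lemma ci_section_measurable[measurable]: "ci x \<in> borel_measurable config_space"
  using measurable_compose[OF measurable_Pair1'[of x borel config_space] ci_measurable] by simp

lemma ci_nonneg: "locally_finite \<xi> \<Longrightarrow> 0 \<le> ci x \<xi>"
  using gibbs by (simp add: gibbs_process_def space_config_space)

lemma \<Xi>_locally_finite: "\<omega> \<in> space M \<Longrightarrow> locally_finite (\<Xi> \<omega>)"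
  using measurable_space[OF \<Xi>_measurable] by (simp add: space_config_space)

text \<open>The Gibbs identity for the increments in \<open>void_prod_step\<close>, weighted by a functional \<open>W\<close>. With
  \<open>W = ci x\<close> this amounts to the Gibbs identity under the reduced Palm measure at \<open>x\<close>.\<close>

lemma gibbs_void_prod:
  assumes u: "retention u" and d[measurable]: "d \<in> borel_measurable borel"
    and W[measurable]: "W \<in> borel_measurable config_space"
  shows "(\<lambda>\<omega>. \<integral>\<^sup>+z. d z * (ennreal (void_prod u (\<Xi> \<omega> - {z})) * W (\<Xi> \<omega> - {z})) \<partial>count_space (\<Xi> \<omega>))
      \<in> borel_measurable M" (is ?A)
    and "(\<integral>\<^sup>+\<omega>. (\<integral>\<^sup>+z. d z * (ennreal (void_prod u (\<Xi> \<omega> - {z})) * W (\<Xi> \<omega> - {z})) \<partial>count_space (\<Xi> \<omega>)) \<partial>M)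
      = (\<integral>\<^sup>+z. d z * (\<integral>\<^sup>+\<omega>. ennreal (void_prod u (\<Xi> \<omega>)) * W (\<Xi> \<omega>) * ennreal (ci z (\<Xi> \<omega>)) \<partial>M) \<partial>lborel)" (is ?B)
proof -
  note [measurable] = void_prod_measurable[OF u]
  show ?A
  proof (rule config_integral_measurable[OF \<Xi>_measurable])
    have [measurable]: "(\<lambda>z. \<Xi> (fst z) - {snd z}) \<in> measurable (M \<Otimes>\<^sub>M borel) config_space"
      by (rule config_remove_measurable) measurable
    show "(\<lambda>(\<omega>, z). d z * (ennreal (void_prod u (\<Xi> \<omega> - {z})) * W (\<Xi> \<omega> - {z})))
        \<in> borel_measurable (M \<Otimes>\<^sub>M borel)"
      unfolding case_prod_beta' by measurable
  qed
  have "(\<integral>\<^sup>+\<omega>. d z * (ennreal (void_prod u (\<Xi> \<omega>)) * W (\<Xi> \<omega>)) * ennreal (ci z (\<Xi> \<omega>)) \<partial>M)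
      = d z * (\<integral>\<^sup>+\<omega>. ennreal (void_prod u (\<Xi> \<omega>)) * W (\<Xi> \<omega>) * ennreal (ci z (\<Xi> \<omega>)) \<partial>M)" for z
    by (subst nn_integral_cmult[symmetric]) (simp_all add: mult.assoc)
  then show ?B
    using gibbs_process_ennreal[OF gibbs, of "\<lambda>p. d (fst p) * (ennreal (void_prod u (snd p)) * W (snd p))"]
    by simp
qed

text \<open>One step of the discrete Groenwall argument. That \<open>W\<close> is decreasing allows
  \<open>W (\<Xi> \<omega>)\<close> to be replaced by \<open>W (\<Xi> \<omega> - {z})\<close> before the Gibbs identity is applied, and
  bounding the conditional intensity by \<open>\<beta>\<close> then reproduces the left-hand side.\<close>

lemma weighted_void_step:
  assumes v: "retention v" and w: "retention w" and vw: "\<And>x. v x \<le> w x"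
    and W[measurable]: "W \<in> borel_measurable config_space"
    and W_dec: "\<And>z \<xi>. locally_finite \<xi> \<Longrightarrow> W (insert z \<xi>) \<le> W \<xi>"
  shows "(\<integral>\<^sup>+\<omega>. ennreal (void_prod v (\<Xi> \<omega>)) * W (\<Xi> \<omega>) \<partial>M)
    \<le> (\<integral>\<^sup>+\<omega>. ennreal (void_prod w (\<Xi> \<omega>)) * W (\<Xi> \<omega>) \<partial>M)
      + ennreal (\<beta> * (\<integral>z. w z - v z \<partial>lborel)) * (\<integral>\<^sup>+\<omega>. ennreal (void_prod v (\<Xi> \<omega>)) * W (\<Xi> \<omega>) \<partial>M)"
    (is "?V \<le> ?W + _")
proof -
  note [measurable] = void_prod_measurable[OF v] void_prod_measurable[OF w] retentionD(1)[OF v] retentionD(1)[OF w]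
  let ?R = "\<lambda>\<omega>. \<integral>\<^sup>+z. ennreal (w z - v z) * (ennreal (void_prod v (\<Xi> \<omega> - {z})) * W (\<Xi> \<omega> - {z})) \<partial>count_space (\<Xi> \<omega>)"
  have R[measurable]: "?R \<in> borel_measurable M" by (rule gibbs_void_prod(1)[OF v]) measurable
  have "?V \<le> (\<integral>\<^sup>+\<omega>. ennreal (void_prod w (\<Xi> \<omega>)) * W (\<Xi> \<omega>) + ?R \<omega> \<partial>M)"
  proof (rule nn_integral_mono)
    fix \<omega> assume "\<omega> \<in> space M"
    then have lf: "locally_finite (\<Xi> \<omega>)" by (rule \<Xi>_locally_finite)
    have "ennreal (void_prod v (\<Xi> \<omega>)) * W (\<Xi> \<omega>) \<le> ennreal (void_prod w (\<Xi> \<omega>)) * W (\<Xi> \<omega>)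
        + (\<integral>\<^sup>+z. ennreal (w z - v z) * ennreal (void_prod v (\<Xi> \<omega> - {z})) * W (\<Xi> \<omega>) \<partial>count_space (\<Xi> \<omega>))"
      using mult_right_mono[OF void_prod_step_upper[OF v w vw lf], of "W (\<Xi> \<omega>)"]
      by (simp add: distrib_right nn_integral_multc)
    also have "(\<integral>\<^sup>+z. ennreal (w z - v z) * ennreal (void_prod v (\<Xi> \<omega> - {z})) * W (\<Xi> \<omega>) \<partial>count_space (\<Xi> \<omega>)) \<le> ?R \<omega>"
    proof (rule nn_integral_mono)
      fix z assume "z \<in> space (count_space (\<Xi> \<omega>))"
      then have "W (\<Xi> \<omega>) \<le> W (\<Xi> \<omega> - {z})"
        using W_dec[of "\<Xi> \<omega> - {z}" z] locally_finite_subset[OF lf, of "\<Xi> \<omega> - {z}"] by (simp add: insert_absorb)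
      then show "ennreal (w z - v z) * ennreal (void_prod v (\<Xi> \<omega> - {z})) * W (\<Xi> \<omega>)
          \<le> ennreal (w z - v z) * (ennreal (void_prod v (\<Xi> \<omega> - {z})) * W (\<Xi> \<omega> - {z}))"
        unfolding mult.assoc by (intro mult_left_mono) auto
    qed
    finally show "ennreal (void_prod v (\<Xi> \<omega>)) * W (\<Xi> \<omega>) \<le> ennreal (void_prod w (\<Xi> \<omega>)) * W (\<Xi> \<omega>) + ?R \<omega>"
      by (simp add: add_left_mono)
  qed
  also have "\<dots> = ?W + (\<integral>\<^sup>+\<omega>. ?R \<omega> \<partial>M)" by (rule nn_integral_add) measurable
  also have "(\<integral>\<^sup>+\<omega>. ?R \<omega> \<partial>M)
      = (\<integral>\<^sup>+z. ennreal (w z - v z) * (\<integral>\<^sup>+\<omega>. ennreal (void_prod v (\<Xi> \<omega>)) * W (\<Xi> \<omega>) * ennreal (ci z (\<Xi> \<omega>)) \<partial>M) \<partial>lborel)"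
    by (rule gibbs_void_prod(2)[OF v]) measurable
  also have "\<dots> \<le> (\<integral>\<^sup>+z. ennreal (w z - v z) * (?V * ennreal \<beta>) \<partial>lborel)"
    by (subst nn_integral_multc[symmetric], measurable)
      (intro nn_integral_mono mult_left_mono ennreal_leI ci_le \<Xi>_locally_finite, auto)
  also have "\<dots> = ennreal (\<integral>z. w z - v z \<partial>lborel) * (?V * ennreal \<beta>)"
    using vw retention_integrable[OF v] retention_integrable[OF w]
    by (subst nn_integral_multc) (auto simp: nn_integral_eq_integral)
  also have "\<dots> = ennreal (\<beta> * (\<integral>z. w z - v z \<partial>lborel)) * ?V"
    using vw \<beta>_pos by (subst ennreal_mult) (auto simp: mult_ac)
  finally show ?thesis by (simp add: add_left_mono)
qed

text \<open>Comparison with a Poisson process of intensity \<open>\<beta>\<close>, whose void probability is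
  \<open>exp (- \<beta> * \<integral>u)\<close>. Increasing the retention function from \<open>a * u\<close> to \<open>b * u\<close> costs at most the
  factor \<open>1 - c * (b - a)\<close>; with \<open>n\<close> equal steps this gives \<open>(1 - c / n) ^ n\<close>, which tends to
  \<open>exp (- c)\<close>.\<close>

lemma void_prod_weighted_ge:
  fixes W :: "'a set \<Rightarrow> real"
  assumes u: "retention u"
    and W[measurable]: "W \<in> borel_measurable config_space"
    and W_bounds: "\<And>\<xi>. locally_finite \<xi> \<Longrightarrow> 0 \<le> W \<xi> \<and> W \<xi> \<le> C"
    and W_dec: "\<And>z \<xi>. locally_finite \<xi> \<Longrightarrow> W (insert z \<xi>) \<le> W \<xi>"
  shows "exp (- \<beta> * (\<integral>z. u z \<partial>lborel)) * expectation (\<lambda>\<omega>. W (\<Xi> \<omega>))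
    \<le> expectation (\<lambda>\<omega>. void_prod u (\<Xi> \<omega>) * W (\<Xi> \<omega>))"
proof -
  define c where "c = \<beta> * (\<integral>z. u z \<partial>lborel)"
  define H where "H s = expectation (\<lambda>\<omega>. void_prod (\<lambda>z. s * u z) (\<Xi> \<omega>) * W (\<Xi> \<omega>))" for s
  have c0: "0 \<le> c" using \<beta>_pos retentionD(2)[OF u] by (auto simp: c_def)
  have H_nn: "ennreal (H s) = (\<integral>\<^sup>+\<omega>. ennreal (void_prod (\<lambda>z. s * u z) (\<Xi> \<omega>)) * ennreal (W (\<Xi> \<omega>)) \<partial>M)"
    and H0: "0 \<le> H s" if s: "0 \<le> s" "s \<le> 1" for s
  proof -
    note r = retention_scale[OF u s]
    note [measurable] = void_prod_measurable[OF r]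
    have b: "0 \<le> void_prod (\<lambda>z. s * u z) (\<Xi> \<omega>) * W (\<Xi> \<omega>)"
      "void_prod (\<lambda>z. s * u z) (\<Xi> \<omega>) * W (\<Xi> \<omega>) \<le> 1 * C" if "\<omega> \<in> space M" for \<omega>
      using void_prod_bounds[OF r \<Xi>_locally_finite[OF that]] W_bounds[OF \<Xi>_locally_finite[OF that]]
      by (intro mult_nonneg_nonneg mult_mono; simp)+
    have "integrable M (\<lambda>\<omega>. void_prod (\<lambda>z. s * u z) (\<Xi> \<omega>) * W (\<Xi> \<omega>))"
      using b by (intro integrable_const_bound[of _ "1 * C"]) (auto intro!: AE_I2)
    then have "(\<integral>\<^sup>+\<omega>. ennreal (void_prod (\<lambda>z. s * u z) (\<Xi> \<omega>) * W (\<Xi> \<omega>)) \<partial>M) = ennreal (H s)"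
      unfolding H_def using b by (intro nn_integral_eq_integral) (auto intro!: AE_I2)
    also have "(\<integral>\<^sup>+\<omega>. ennreal (void_prod (\<lambda>z. s * u z) (\<Xi> \<omega>) * W (\<Xi> \<omega>)) \<partial>M)
        = (\<integral>\<^sup>+\<omega>. ennreal (void_prod (\<lambda>z. s * u z) (\<Xi> \<omega>)) * ennreal (W (\<Xi> \<omega>)) \<partial>M)"
      using void_prod_bounds[OF r \<Xi>_locally_finite] W_bounds[OF \<Xi>_locally_finite]
      by (intro nn_integral_cong) (auto intro!: ennreal_mult)
    finally show "ennreal (H s) = (\<integral>\<^sup>+\<omega>. ennreal (void_prod (\<lambda>z. s * u z) (\<Xi> \<omega>)) * ennreal (W (\<Xi> \<omega>)) \<partial>M)" ..
    show "0 \<le> H s" unfolding H_def using b by (intro Bochner_Integration.integral_nonneg) auto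
  qed
  have step: "(1 - c * (b - a)) * H a \<le> H b" if ab: "0 \<le> a" "a \<le> b" "b \<le> 1" for a b
  proof -
    have a1: "a \<le> 1" and b0: "0 \<le> b" using ab by auto
    have "ennreal (H a) \<le> ennreal (H b) + ennreal (\<beta> * (\<integral>z. b * u z - a * u z \<partial>lborel)) * ennreal (H a)"
      unfolding H_nn[OF ab(1) a1] H_nn[OF b0 ab(3)] using ab retentionD[OF u] W_dec
      by (intro weighted_void_step retention_scale u) (auto intro!: mult_right_mono ennreal_leI)
    also have "\<beta> * (\<integral>z. b * u z - a * u z \<partial>lborel) = c * (b - a)"
    proof -
      have "(\<integral>z. b * u z - a * u z \<partial>lborel) = (\<integral>z. (b - a) * u z \<partial>lborel)"
        by (simp only: left_diff_distrib)
      then show ?thesis by (simp add: c_def)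
    qed
    finally have "ennreal (H a) \<le> ennreal (H b + c * (b - a) * H a)"
      using c0 ab H0[OF ab(1) a1] H0[OF b0 ab(3)] by (simp add: ennreal_mult ennreal_plus)
    then have "H a \<le> H b + c * (b - a) * H a"
      using c0 ab H0[OF ab(1) a1] H0[OF b0 ab(3)] by (subst (asm) ennreal_le_iff) auto
    then show ?thesis by (simp add: algebra_simps)
  qed
  \<comment> \<open>For \<open>n \<ge> c\<close> the step factor is nonnegative, so that the steps can be multiplied.\<close>
  have "(1 + (- c) / real n) ^ n * H 0 \<le> H 1" if n: "c \<le> real n" "0 < n" for n
  proof -
    have pos: "0 \<le> 1 - c / real n" using n by simp
    have "(1 - c / real n) ^ k * H 0 \<le> H (real k / real n)" if "k \<le> n" for k
      using that
    proof (induction k)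
      case (Suc k)
      have "(1 - c / real n) ^ Suc k * H 0 \<le> (1 - c / real n) * H (real k / real n)"
        using Suc pos by (simp add: mult.assoc mult_left_mono)
      also have "\<dots> = (1 - c * (real (Suc k) / real n - real k / real n)) * H (real k / real n)"
        using n by (simp add: field_simps)
      also have "\<dots> \<le> H (real (Suc k) / real n)"
        using Suc n by (intro step) (auto simp: field_simps)
      finally show ?case .
    qed simp
    from this[of n] show ?thesis using n by simp
  qed
  then have "\<forall>\<^sub>F n in sequentially. (1 + (- c) / real n) ^ n * H 0 \<le> H 1"
    using eventually_ge_at_top[of "max 1 (nat \<lceil>c\<rceil>)"]
    by (rule eventually_mono[rotated]) (auto simp: nat_le_iff ceiling_le_iff)
  then have "exp (- c) * H 0 \<le> H 1"
    by (rule tendsto_upperbound[OF tendsto_mult[OF tendsto_exp_limit_sequentially tendsto_const]]) simp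
  then show ?thesis by (simp add: H_def c_def void_prod_zero)
qed

lemma void_prod_expectation:
  assumes u: "retention u"
  shows "(\<integral>\<^sup>+\<omega>. ennreal (void_prod u (\<Xi> \<omega>)) \<partial>M) = ennreal (expectation (\<lambda>\<omega>. void_prod u (\<Xi> \<omega>)))"
    and "0 \<le> expectation (\<lambda>\<omega>. void_prod u (\<Xi> \<omega>))"
proof -
  note [measurable] = void_prod_measurable[OF u]
  note b = void_prod_bounds[OF u \<Xi>_locally_finite]
  have "integrable M (\<lambda>\<omega>. void_prod u (\<Xi> \<omega>))"
    using b by (intro integrable_const_bound[of _ 1]) (auto intro!: AE_I2)
  then show "(\<integral>\<^sup>+\<omega>. ennreal (void_prod u (\<Xi> \<omega>)) \<partial>M) = ennreal (expectation (\<lambda>\<omega>. void_prod u (\<Xi> \<omega>)))"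
    using b by (intro nn_integral_eq_integral) (auto intro!: AE_I2)
  show "0 \<le> expectation (\<lambda>\<omega>. void_prod u (\<Xi> \<omega>))"
    using b by (intro Bochner_Integration.integral_nonneg) auto
qed

lemma ci_integrable: "integrable M (\<lambda>\<omega>. ci z (\<Xi> \<omega>))"
  using ci_nonneg[OF \<Xi>_locally_finite] ci_le[OF \<Xi>_locally_finite]
  by (intro integrable_const_bound[of _ \<beta>]) (auto intro!: AE_I2)

text \<open>The union bound: the probability of retaining some point is at most the expected number of
  retained points. It is the case of \<open>void_prod_step_upper\<close> starting from the zero function.\<close>

lemma void_probability_ge:
  assumes u: "retention u" and lam: "\<And>x. expectation (\<lambda>\<omega>. ci x (\<Xi> \<omega>)) = lam"
  shows "1 - lam * (\<integral>z. u z \<partial>lborel) \<le> expectation (\<lambda>\<omega>. void_prod u (\<Xi> \<omega>))"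
proof -
  let ?G = "\<integral>z. u z \<partial>lborel" and ?\<Psi> = "expectation (\<lambda>\<omega>. void_prod u (\<Xi> \<omega>))"
  let ?R = "\<lambda>\<omega>. \<integral>\<^sup>+z. ennreal (u z) * (ennreal (void_prod (\<lambda>z. 0) (\<Xi> \<omega> - {z})) * 1) \<partial>count_space (\<Xi> \<omega>)"
  have r0: "retention (\<lambda>z. 0)" by (simp add: retention_def)
  note [measurable] = retentionD(1)[OF u] void_prod_measurable[OF u]
  have [measurable]: "?R \<in> borel_measurable M" by (rule gibbs_void_prod(1)[OF r0]) measurable
  have lam0: "0 \<le> lam"
    unfolding lam[of 0, symmetric] using ci_nonneg[OF \<Xi>_locally_finite]
    by (intro Bochner_Integration.integral_nonneg) auto
  have G0: "0 \<le> ?G" using retentionD(2)[OF u] by simp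
  have "(1::ennreal) = (\<integral>\<^sup>+\<omega>. 1 \<partial>M)" by (simp add: emeasure_space_1)
  also have "\<dots> \<le> (\<integral>\<^sup>+\<omega>. ennreal (void_prod u (\<Xi> \<omega>)) + ?R \<omega> \<partial>M)"
    using void_prod_step_upper[OF r0 u retentionD(2)[OF u] \<Xi>_locally_finite]
    by (intro nn_integral_mono) (simp add: void_prod_zero)
  also have "\<dots> = (\<integral>\<^sup>+\<omega>. ennreal (void_prod u (\<Xi> \<omega>)) \<partial>M) + (\<integral>\<^sup>+\<omega>. ?R \<omega> \<partial>M)"
    by (rule nn_integral_add) measurable
  also have "(\<integral>\<^sup>+\<omega>. ?R \<omega> \<partial>M) = (\<integral>\<^sup>+z. ennreal (u z) * (\<integral>\<^sup>+\<omega>. ennreal (ci z (\<Xi> \<omega>)) \<partial>M) \<partial>lborel)"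
    using gibbs_void_prod(2)[OF r0, of "\<lambda>z. ennreal (u z)" "\<lambda>_. 1"] by (simp add: void_prod_zero)
  also have "\<dots> = (\<integral>\<^sup>+z. ennreal (u z) * ennreal lam \<partial>lborel)"
    using ci_nonneg[OF \<Xi>_locally_finite] ci_integrable
    by (subst nn_integral_eq_integral) (auto simp: lam)
  also have "\<dots> = ennreal (lam * ?G)"
    using retention_integrable[OF u] retentionD(2)[OF u] lam0 G0
    by (subst nn_integral_multc) (auto simp: nn_integral_eq_integral ennreal_mult mult.commute)
  finally have "ennreal 1 \<le> ennreal (?\<Psi> + lam * ?G)"
    using void_prod_expectation[OF u] lam0 G0 by (simp add: ennreal_plus)
  then show ?thesis
    using void_prod_expectation(2)[OF u] lam0 G0 by (subst (asm) ennreal_le_iff) auto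
qed

text \<open>The Gibbs identity turns the decrease of the void probability into an integral of
  \<open>E (void_prod w \<Xi> * ci z \<Xi>)\<close>. As \<open>ci z\<close> is itself a decreasing functional, it can serve as the
  weight in the Poisson comparison.\<close>

lemma void_probability_step:
  assumes v: "retention v" and w: "retention w" and vw: "\<And>x. v x \<le> w x"
    and lam: "\<And>x. expectation (\<lambda>\<omega>. ci x (\<Xi> \<omega>)) = lam"
  shows "expectation (\<lambda>\<omega>. void_prod w (\<Xi> \<omega>))
      + (\<integral>z. w z - v z \<partial>lborel) * (lam * exp (- \<beta> * (\<integral>z. w z \<partial>lborel)))
    \<le> expectation (\<lambda>\<omega>. void_prod v (\<Xi> \<omega>))"
proof -
  let ?d = "\<integral>z. w z - v z \<partial>lborel" and ?e = "lam * exp (- \<beta> * (\<integral>z. w z \<partial>lborel))"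
  let ?R = "\<lambda>\<omega>. \<integral>\<^sup>+z. ennreal (w z - v z) * (ennreal (void_prod w (\<Xi> \<omega> - {z})) * 1) \<partial>count_space (\<Xi> \<omega>)"
  note [measurable] = retentionD(1)[OF v] retentionD(1)[OF w] void_prod_measurable[OF v] void_prod_measurable[OF w]
  have [measurable]: "?R \<in> borel_measurable M" by (rule gibbs_void_prod(1)[OF w]) measurable
  have lam0: "0 \<le> lam"
    unfolding lam[of 0, symmetric] using ci_nonneg[OF \<Xi>_locally_finite]
    by (intro Bochner_Integration.integral_nonneg) auto
  have d0: "0 \<le> ?d" using vw by simp
  have palm: "ennreal ?e \<le> (\<integral>\<^sup>+\<omega>. ennreal (void_prod w (\<Xi> \<omega>)) * ennreal (ci z (\<Xi> \<omega>)) \<partial>M)" for z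
  proof -
    have b: "0 \<le> void_prod w (\<Xi> \<omega>)" "0 \<le> ci z (\<Xi> \<omega>)"
      "void_prod w (\<Xi> \<omega>) * ci z (\<Xi> \<omega>) \<le> 1 * \<beta>" if "\<omega> \<in> space M" for \<omega>
      using void_prod_bounds[OF w \<Xi>_locally_finite[OF that]] ci_le[OF \<Xi>_locally_finite[OF that], of z]
        ci_nonneg[OF \<Xi>_locally_finite[OF that], of z]
      by (simp, simp, intro mult_mono) simp_all
    have "integrable M (\<lambda>\<omega>. void_prod w (\<Xi> \<omega>) * ci z (\<Xi> \<omega>))"
      using b by (intro integrable_const_bound[of _ "1 * \<beta>"]) (auto intro!: AE_I2)
    then have "(\<integral>\<^sup>+\<omega>. ennreal (void_prod w (\<Xi> \<omega>) * ci z (\<Xi> \<omega>)) \<partial>M)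
        = ennreal (expectation (\<lambda>\<omega>. void_prod w (\<Xi> \<omega>) * ci z (\<Xi> \<omega>)))"
      using b by (intro nn_integral_eq_integral) (auto intro!: AE_I2)
    moreover have "?e \<le> expectation (\<lambda>\<omega>. void_prod w (\<Xi> \<omega>) * ci z (\<Xi> \<omega>))"
      using void_prod_weighted_ge[OF w, of "ci z" \<beta>] ci_nonneg ci_le ci_insert
      by (simp add: lam mult.commute)
    moreover have "(\<integral>\<^sup>+\<omega>. ennreal (void_prod w (\<Xi> \<omega>) * ci z (\<Xi> \<omega>)) \<partial>M)
        = (\<integral>\<^sup>+\<omega>. ennreal (void_prod w (\<Xi> \<omega>)) * ennreal (ci z (\<Xi> \<omega>)) \<partial>M)"
      using b by (intro nn_integral_cong ennreal_mult) auto
    ultimately show ?thesis by (simp add: ennreal_leI)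
  qed
  have "ennreal (?d * ?e) = (\<integral>\<^sup>+z. ennreal (w z - v z) * ennreal ?e \<partial>lborel)"
    using vw retention_integrable[OF v] retention_integrable[OF w] lam0 d0
    by (subst nn_integral_multc) (auto simp: nn_integral_eq_integral ennreal_mult)
  also have "\<dots> \<le> (\<integral>\<^sup>+z. ennreal (w z - v z)
      * (\<integral>\<^sup>+\<omega>. ennreal (void_prod w (\<Xi> \<omega>)) * 1 * ennreal (ci z (\<Xi> \<omega>)) \<partial>M) \<partial>lborel)"
    using palm by (intro nn_integral_mono mult_left_mono) auto
  also have "\<dots> = (\<integral>\<^sup>+\<omega>. ?R \<omega> \<partial>M)"
    by (rule gibbs_void_prod(2)[OF w, symmetric]) measurable
  finally have "ennreal (expectation (\<lambda>\<omega>. void_prod w (\<Xi> \<omega>))) + ennreal (?d * ?e)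
      \<le> (\<integral>\<^sup>+\<omega>. ennreal (void_prod w (\<Xi> \<omega>)) \<partial>M) + (\<integral>\<^sup>+\<omega>. ?R \<omega> \<partial>M)"
    unfolding void_prod_expectation(1)[OF w] by (rule add_left_mono)
  also have "\<dots> = (\<integral>\<^sup>+\<omega>. ennreal (void_prod w (\<Xi> \<omega>)) + ?R \<omega> \<partial>M)"
    by (rule nn_integral_add[symmetric]) measurable
  also have "\<dots> \<le> (\<integral>\<^sup>+\<omega>. ennreal (void_prod v (\<Xi> \<omega>)) \<partial>M)"
    using void_prod_step_lower[OF v w vw \<Xi>_locally_finite] by (intro nn_integral_mono) simp
  finally have "ennreal (expectation (\<lambda>\<omega>. void_prod w (\<Xi> \<omega>)) + ?d * ?e)
      \<le> ennreal (expectation (\<lambda>\<omega>. void_prod v (\<Xi> \<omega>)))"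
    using void_prod_expectation[OF v] void_prod_expectation(2)[OF w] lam0 d0 by (simp add: ennreal_plus)
  then show ?thesis
    using void_prod_expectation(2)[OF v] by (subst (asm) ennreal_le_iff) auto
qed

text \<open>Summing the steps over the grid \<open>k / n\<close> gives a Riemann sum for
  \<open>\<integral>\<^sub>0\<^sup>1 c * exp (- c * s) ds = 1 - exp (- c)\<close>. The sum is geometric, hence equal to
  \<open>(c / n) / (exp (c / n) - 1) * (1 - exp (- c))\<close>, and the first factor tends to 1.\<close>

lemma void_probability_le:
  assumes u: "retention u" and lam: "\<And>x. expectation (\<lambda>\<omega>. ci x (\<Xi> \<omega>)) = lam"
  shows "expectation (\<lambda>\<omega>. void_prod u (\<Xi> \<omega>)) \<le> 1 - lam / \<beta> * (1 - exp (- \<beta> * (\<integral>z. u z \<partial>lborel)))"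
proof (cases "(\<integral>z. u z \<partial>lborel) = 0")
  case True
  have "expectation (\<lambda>\<omega>. void_prod u (\<Xi> \<omega>)) \<le> expectation (\<lambda>\<omega>. void_prod (\<lambda>z. 0) (\<Xi> \<omega>))"
    using void_probability_step[OF _ u retentionD(2)[OF u] lam] True by (simp add: retention_def)
  then show ?thesis using True by (simp add: void_prod_zero prob_space)
next
  case False
  define G where "G = (\<integral>z. u z \<partial>lborel)"
  define c where "c = \<beta> * G"
  define \<Psi> where "\<Psi> s = expectation (\<lambda>\<omega>. void_prod (\<lambda>z. s * u z) (\<Xi> \<omega>))" for s
  have "0 \<le> G" using retentionD(2)[OF u] by (simp add: G_def)
  then have c0: "0 < c" using False \<beta>_pos by (simp add: c_def G_def)
  have step: "\<Psi> b + lam / \<beta> * (c * (b - a)) * exp (- c * b) \<le> \<Psi> a" if "0 \<le> a" "a \<le> b" "b \<le> 1" for a b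
  proof -
    have "retention (\<lambda>z. a * u z)" "retention (\<lambda>z. b * u z)"
      using that by (auto intro!: retention_scale u)
    from void_probability_step[OF this _ lam] that retentionD(2)[OF u]
    have "\<Psi> b + (\<integral>z. b * u z - a * u z \<partial>lborel) * (lam * exp (- \<beta> * (\<integral>z. b * u z \<partial>lborel))) \<le> \<Psi> a"
      by (simp add: \<Psi>_def mult_right_mono)
    moreover have "(\<integral>z. b * u z - a * u z \<partial>lborel) = (\<integral>z. (b - a) * u z \<partial>lborel)"
      by (simp only: left_diff_distrib)
    ultimately show ?thesis using \<beta>_pos by (simp add: c_def G_def mult_ac)
  qed
  define q where "q n = exp (- c / real n)" for n :: nat
  have sum: "\<Psi> 1 + lam / \<beta> * (c / real n) * (\<Sum>k=1..n. q n ^ k) \<le> 1" if n: "0 < n" for n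
  proof -
    have "\<Psi> (real m / real n) + lam / \<beta> * (c / real n) * (\<Sum>k=1..m. q n ^ k) \<le> 1" if "m \<le> n" for m
      using that
    proof (induction m)
      case 0
      then show ?case by (simp add: \<Psi>_def void_prod_zero prob_space)
    next
      case (Suc m)
      have "\<Psi> (real (Suc m) / real n) + lam / \<beta> * (c * (real (Suc m) / real n - real m / real n))
          * exp (- c * (real (Suc m) / real n)) \<le> \<Psi> (real m / real n)"
        using Suc n by (intro step) (auto simp: field_simps)
      moreover have "exp (- c * (real (Suc m) / real n)) = q n ^ Suc m"
        unfolding q_def exp_of_nat_mult[symmetric] by (simp add: mult.commute)
      moreover have "real (Suc m) / real n - real m / real n = 1 / real n"
        using n by (simp add: field_simps)
      ultimately show ?case using Suc by (simp add: distrib_left mult_ac)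
    qed
    from this[of n] show ?thesis using n by simp
  qed
  have "\<Psi> 1 + lam / \<beta> * ((c / real n) / (exp (c / real n) - 1)) * (1 - exp (- c)) \<le> 1" if n: "0 < n" for n
  proof -
    have q1: "q n \<noteq> 1" "q n \<noteq> 0" "q n * exp (c / real n) = 1"
      using c0 n by (auto simp: q_def exp_minus field_simps)
    have "(\<Sum>k=1..n. q n ^ k) = q n * (\<Sum>k<n. q n ^ k)"
      by (simp add: sum_distrib_left sum.atLeast1_atMost_eq)
    also have "\<dots> = q n * ((1 - q n ^ n) / (1 - q n))"
      using q1 by (simp add: geometric_sum divide_simps) (simp add: algebra_simps)
    also have "q n ^ n = exp (- c)"
      unfolding q_def exp_of_nat_mult[symmetric] using n by simp
    also have "q n * ((1 - exp (- c)) / (1 - q n)) = (1 - exp (- c)) / (exp (c / real n) - 1)"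
    proof -
      have "1 - q n = q n * (exp (c / real n) - 1)" using q1 by (simp add: right_diff_distrib)
      then show ?thesis using q1(2) by simp
    qed
    finally show ?thesis using sum[OF n] by simp
  qed
  moreover have "(\<lambda>n. \<Psi> 1 + lam / \<beta> * ((c / real n) / (exp (c / real n) - 1)) * (1 - exp (- c)))
      \<longlonglongrightarrow> \<Psi> 1 + lam / \<beta> * 1 * (1 - exp (- c))"
    using c0 by (intro tendsto_intros) real_asymp
  ultimately have "\<Psi> 1 + lam / \<beta> * 1 * (1 - exp (- c)) \<le> 1"
    by (intro tendsto_upperbound[OF _ _ sequentially_bot]) (auto intro!: eventually_mono[OF eventually_gt_at_top[of 0]])
  then show ?thesis by (simp add: \<Psi>_def c_def G_def)
qed

end


section \<open>Invariance under translations and rotations\<close>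

lemma config_image_measurable:
  fixes Z :: "'p \<Rightarrow> 'a::euclidean_space set" and T :: "'a \<Rightarrow> 'a"
  assumes Z: "Z \<in> measurable P config_space"
    and T: "inj T" "T \<in> borel_measurable borel" "\<And>A. bounded A \<Longrightarrow> bounded (T -` A)"
  shows "(\<lambda>p. T ` Z p) \<in> measurable P config_space"
proof (rule measurable_config_spaceI)
  have vim: "T ` S \<inter> A = T ` (S \<inter> T -` A)" for S A by auto
  show "locally_finite (T ` Z p)" if "p \<in> space P" for p
    using measurable_space[OF Z that] T(3) by (simp add: space_config_space locally_finite_def vim)
  fix A :: "'a set" assume A: "A \<in> sets borel" "bounded A"
  have "T -` A \<in> sets borel" using measurable_sets_borel[OF T(2) A(1)] by simp
  from measurable_config_card[OF this T(3)[OF A(2)] Z]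
  show "(\<lambda>p. card (T ` Z p \<inter> A)) \<in> measurable P (count_space UNIV)"
    using inj_on_subset[OF T(1)] by (simp add: vim card_image)
qed

text \<open>A product over the image of a configuration under \<open>T\<close> is the product over the
  configuration itself with \<open>u\<close> composed with \<open>T\<close>, so invariance of the law transfers to
  void probabilities.\<close>

lemma void_prod_invariant:
  fixes \<Xi> :: "'w \<Rightarrow> 'a::euclidean_space set" and T :: "'a \<Rightarrow> 'a"
  assumes \<Xi>[measurable]: "\<Xi> \<in> measurable M config_space" and u: "retention u"
    and T: "inj T" "T \<in> borel_measurable borel" "\<And>A. bounded A \<Longrightarrow> bounded (T -` A)"
    and inv: "distr M config_space (\<lambda>\<omega>. T ` \<Xi> \<omega>) = distr M config_space \<Xi>"
  shows "(\<integral>\<omega>. void_prod (\<lambda>z. u (T z)) (\<Xi> \<omega>) \<partial>M) = (\<integral>\<omega>. void_prod u (\<Xi> \<omega>) \<partial>M)"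
proof -
  note [measurable] = void_prod_measurable[OF u] config_image_measurable[OF \<Xi> T]
  have "void_prod (\<lambda>z. u (T z)) (\<Xi> \<omega>) = void_prod u (T ` \<Xi> \<omega>)" if \<omega>: "\<omega> \<in> space M" for \<omega>
  proof -
    let ?S = "{z\<in>\<Xi> \<omega>. u (T z) \<noteq> 0}"
    have "?S = \<Xi> \<omega> \<inter> T -` {x. u x \<noteq> 0}" by auto
    then have f: "finite ?S"
      using T(3)[OF retentionD(4)[OF u]] measurable_space[OF \<Xi> \<omega>]
      by (simp add: space_config_space locally_finite_def)
    have "void_prod (\<lambda>z. u (T z)) (\<Xi> \<omega>) = (\<Prod>z\<in>?S. 1 - u (T z))"
      by (rule void_prod_finite[OF f]) auto
    also have "\<dots> = (\<Prod>z\<in>T ` ?S. 1 - u z)"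
      using inj_on_subset[OF T(1), of ?S] by (simp add: prod.reindex)
    also have "\<dots> = void_prod u (T ` \<Xi> \<omega>)"
      using f by (intro void_prod_finite[symmetric]) auto
    finally show ?thesis .
  qed
  then have "(\<integral>\<omega>. void_prod (\<lambda>z. u (T z)) (\<Xi> \<omega>) \<partial>M) = (\<integral>\<omega>. void_prod u (T ` \<Xi> \<omega>) \<partial>M)"
    by (intro Bochner_Integration.integral_cong) auto
  also have "\<dots> = (\<integral>\<xi>. void_prod u \<xi> \<partial>distr M config_space (\<lambda>\<omega>. T ` \<Xi> \<omega>))"
    by (subst integral_distr) auto
  also have "\<dots> = (\<integral>\<omega>. void_prod u (\<Xi> \<omega>) \<partial>M)"
    unfolding inv by (subst integral_distr) auto
  finally show ?thesis .
qed

lemma void_prod_translate: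
  fixes \<Xi> :: "'w \<Rightarrow> 'a::euclidean_space set"
  assumes "\<Xi> \<in> measurable M config_space" "stationary M \<Xi>" "retention u"
  shows "(\<integral>\<omega>. void_prod (\<lambda>z. u (z + v)) (\<Xi> \<omega>) \<partial>M) = (\<integral>\<omega>. void_prod u (\<Xi> \<omega>) \<partial>M)"
proof (rule void_prod_invariant[OF assms(1,3)])
  show "bounded ((\<lambda>z. z + v) -` A)" if "bounded A" for A
  proof -
    have "(\<lambda>z. z + v) -` A = (\<lambda>y. y - v) ` A" by (force simp: image_iff)
    then show ?thesis using bounded_translation_minus[OF that] by simp
  qed
qed (use assms(2) in \<open>auto simp: stationary_def inj_def\<close>)

lemma void_prod_rotate:
  fixes \<Xi> :: "'w \<Rightarrow> (real ^ 'n) set"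
  assumes "\<Xi> \<in> measurable M config_space" "isotropic M \<Xi>" "retention u" "rotation_matrix Q"
  shows "(\<integral>\<omega>. void_prod (\<lambda>z. u (Q *v z)) (\<Xi> \<omega>) \<partial>M) = (\<integral>\<omega>. void_prod u (\<Xi> \<omega>) \<partial>M)"
proof (rule void_prod_invariant[OF assms(1,3)])
  have o: "orthogonal_transformation ((*v) Q)"
    using assms(4) by (simp add: rotation_matrix_def orthogonal_transformation_matrix)
  then have n: "norm (Q *v z) = norm z" for z by (simp add: orthogonal_transformation)
  show "inj ((*v) Q)" using o by (rule orthogonal_transformation_inj)
  show "(*v) Q \<in> borel_measurable borel"
    by (intro borel_measurable_continuous_onI matrix_vector_mult_linear_continuous_on)
  show "bounded ((*v) Q -` A)" if "bounded A" for A
    using that n unfolding bounded_iff by (metis vimageE)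
qed (use assms(2,4) in \<open>auto simp: isotropic_def\<close>)

section \<open>Correlations of pairwise interaction processes\<close>

lemma retention_interaction:
  fixes \<phi> :: "'a::euclidean_space \<Rightarrow> real"
  assumes \<phi>[measurable]: "\<phi> \<in> borel_measurable borel" and "\<And>x. 0 \<le> \<phi> x" "inhibitory \<phi>" "finite_range \<phi>"
  shows "retention (\<lambda>z. 1 - \<phi> (z - x))"
proof -
  have "{z. 1 - \<phi> (z - x) \<noteq> 0} = (\<lambda>z. x + z) ` {z. \<phi> z \<noteq> 1}"
    by (force simp: image_iff intro: exI[of _ "_ - x"])
  then show ?thesis
    using assms bounded_translation[OF finite_range_bounded[OF assms(4)], of x]
    by (auto simp: retention_def inhibitory_def)
qed

text \<open>Retaining a point if at least one of two independent thinnings retains it.\<close>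

lemma retention_mult:
  assumes "retention u" "retention v"
  shows "retention (\<lambda>z. 1 - (1 - u z) * (1 - v z))"
proof -
  note [measurable] = retentionD(1)[OF assms(1)] retentionD(1)[OF assms(2)]
  have "bounded {z. 1 - (1 - u z) * (1 - v z) \<noteq> 0}"
    by (rule bounded_subset[OF bounded_Un[THEN iffD2, OF conjI[OF retentionD(4)[OF assms(1)] retentionD(4)[OF assms(2)]]]])
      auto
  then show ?thesis
    using retentionD(2,3)[OF assms(1)] retentionD(2,3)[OF assms(2)]
    by (auto simp: retention_def intro!: mult_le_one mult_nonneg_nonneg)
qed

lemma retention_pair_interaction:
  fixes \<phi> :: "'a::euclidean_space \<Rightarrow> real"
  assumes "\<phi> \<in> borel_measurable borel" "\<And>x. 0 \<le> \<phi> x" "inhibitory \<phi>" "finite_range \<phi>"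
  shows "retention (\<lambda>z. 1 - \<phi> (z - x) * \<phi> (z - y))"
  using retention_mult[OF retention_interaction[OF assms] retention_interaction[OF assms], of x y] by simp

lemma repulsive_gibbs_PIP:
  assumes pip: "PIP M \<Xi> \<beta> \<phi>" and inh: "inhibitory \<phi>" and fr: "finite_range \<phi>"
  shows "repulsive_gibbs M \<Xi> (pip_intensity \<beta> \<phi>) \<beta>"
proof
  have \<phi>0: "\<And>x. 0 \<le> \<phi> x" and \<beta>: "0 < \<beta>" using pip by (auto simp: PIP_def)
  then show "pip_intensity \<beta> \<phi> x \<xi> \<le> \<beta>" if "locally_finite \<xi>" for x \<xi>
    using pip_intensity_bounds(2)[OF fr that \<phi>0 inh] by simp
  show "pip_intensity \<beta> \<phi> x (insert z \<xi>) \<le> pip_intensity \<beta> \<phi> x \<xi>" if "locally_finite \<xi>" for x z \<xi>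
  proof (cases "z \<in> \<xi>")
    case False
    then show ?thesis
      using pip_intensity_insert[OF fr that False] pip_intensity_bounds(1)[OF fr that \<phi>0 inh, of \<beta> x] \<beta> \<phi>0 inh
      by (simp add: inhibitory_def mult_left_le_one_le)
  qed (simp add: insert_absorb)
qed (use pip in \<open>auto simp: PIP_def\<close>)

lemma PIP_intensity_const:
  assumes pip: "PIP M \<Xi> \<beta> \<phi>" and inh: "inhibitory \<phi>" and fr: "finite_range \<phi>"
  shows "(\<integral>\<omega>. pip_intensity \<beta> \<phi> x (\<Xi> \<omega>) \<partial>M) = intensity M \<Xi> (pip_intensity \<beta> \<phi>)"
proof -
  interpret repulsive_gibbs M \<Xi> "pip_intensity \<beta> \<phi>" \<beta> by (rule repulsive_gibbs_PIP[OF assms])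
  have p: "\<phi> \<in> borel_measurable borel" "\<And>x. 0 \<le> \<phi> x" "stationary M \<Xi>" "\<And>x. \<phi> (- x) = \<phi> x"
    using pip by (auto simp: PIP_def)
  have eq: "pip_intensity \<beta> \<phi> y \<xi> = \<beta> * void_prod (\<lambda>z. 1 - \<phi> (z - y)) \<xi>" for y \<xi>
    using p(4)[of "_ - y"] by (simp add: pip_intensity_def void_prod_def)
  have "(\<integral>\<omega>. void_prod (\<lambda>z. 1 - \<phi> (z + x - x)) (\<Xi> \<omega>) \<partial>M) = (\<integral>\<omega>. void_prod (\<lambda>z. 1 - \<phi> (z - x)) (\<Xi> \<omega>) \<partial>M)"
    by (rule void_prod_translate[OF \<Xi>_measurable p(3) retention_interaction[OF p(1,2) inh fr]])
  then show ?thesis by (simp add: eq intensity_def)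
qed

lemma pip_correlation2_void_prod:
  "pip_correlation2 M \<Xi> \<beta> \<phi> x y
    = \<beta>\<^sup>2 * \<phi> (x - y) * (\<integral>\<omega>. void_prod (\<lambda>z. 1 - \<phi> (z - x) * \<phi> (z - y)) (\<Xi> \<omega>) \<partial>M)"
  by (simp add: pip_correlation2_def void_prod_def)

lemma pip_correlation2_translate:
  assumes pip: "PIP M \<Xi> \<beta> \<phi>" and inh: "inhibitory \<phi>" and fr: "finite_range \<phi>"
  shows "pip_correlation2 M \<Xi> \<beta> \<phi> (x + v) (y + v) = pip_correlation2 M \<Xi> \<beta> \<phi> x y"
proof -
  interpret repulsive_gibbs M \<Xi> "pip_intensity \<beta> \<phi>" \<beta> by (rule repulsive_gibbs_PIP[OF assms])
  have p: "\<phi> \<in> borel_measurable borel" "\<And>x. 0 \<le> \<phi> x" "stationary M \<Xi>"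
    using pip by (auto simp: PIP_def)
  have "(\<integral>\<omega>. void_prod (\<lambda>z. 1 - \<phi> (z + v - (x + v)) * \<phi> (z + v - (y + v))) (\<Xi> \<omega>) \<partial>M)
      = (\<integral>\<omega>. void_prod (\<lambda>z. 1 - \<phi> (z - (x + v)) * \<phi> (z - (y + v))) (\<Xi> \<omega>) \<partial>M)"
    by (rule void_prod_translate[OF \<Xi>_measurable p(3) retention_pair_interaction[OF p(1,2) inh fr]])
  then show ?thesis unfolding pip_correlation2_void_prod add_diff_cancel_right by simp
qed

lemma pip_correlation2_commute:
  assumes "\<And>x. \<phi> (- x) = \<phi> x"
  shows "pip_correlation2 M \<Xi> \<beta> \<phi> x y = pip_correlation2 M \<Xi> \<beta> \<phi> y x"
  using assms[of "x - y"] by (simp add: pip_correlation2_def mult.commute)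

lemma pip_correlation2_rotate:
  fixes \<Xi> :: "'w \<Rightarrow> (real ^ 'n) set"
  assumes pip: "PIP M \<Xi> \<beta> \<phi>" and inh: "inhibitory \<phi>" and fr: "finite_range \<phi>"
    and iso: "isotropic M \<Xi>" and rad: "radial \<phi>" and Q: "rotation_matrix Q"
  shows "pip_correlation2 M \<Xi> \<beta> \<phi> (Q *v x) (Q *v y) = pip_correlation2 M \<Xi> \<beta> \<phi> x y"
proof -
  interpret repulsive_gibbs M \<Xi> "pip_intensity \<beta> \<phi>" \<beta> by (rule repulsive_gibbs_PIP[OF pip inh fr])
  have p: "\<phi> \<in> borel_measurable borel" "\<And>x. 0 \<le> \<phi> x" using pip by (auto simp: PIP_def)
  have "norm (Q *v z) = norm z" for z
    using Q by (metis orthogonal_transformation orthogonal_transformation_matrix matrix_of_matrix_vector_mul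
        matrix_vector_mul_linear rotation_matrix_def)
  then have "\<phi> (Q *v z - Q *v w) = \<phi> (z - w)" for z w
    using rad unfolding radial_def by (metis matrix_vector_mult_diff_distrib)
  then show ?thesis
    using void_prod_rotate[OF \<Xi>_measurable iso retention_pair_interaction[OF p inh fr] Q, of "Q *v x" "Q *v y"]
    by (simp add: pip_correlation2_void_prod)
qed

text \<open>In dimension at least two, rotations act transitively on differences of equal norm. In
  dimension one the only rotation is the identity, but two differences of equal norm agree up to
  sign, and the sign is changed by exchanging the points.\<close>

lemma pip_correlation2_radial:
  fixes \<Xi> :: "'w \<Rightarrow> (real ^ 'n) set"
  assumes pip: "PIP M \<Xi> \<beta> \<phi>" and inh: "inhibitory \<phi>" and fr: "finite_range \<phi>"
    and iso: "isotropic M \<Xi>" and rad: "radial \<phi>" and eq: "norm (x - y) = norm (x' - y')"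
  shows "pip_correlation2 M \<Xi> \<beta> \<phi> x y = pip_correlation2 M \<Xi> \<beta> \<phi> x' y'"
proof -
  have red: "pip_correlation2 M \<Xi> \<beta> \<phi> x y = pip_correlation2 M \<Xi> \<beta> \<phi> (x - y) 0" for x y
    using pip_correlation2_translate[OF pip inh fr, of "x - y" y 0] by simp
  have sym: "\<And>x. \<phi> (- x) = \<phi> x" using pip by (simp add: PIP_def)
  show ?thesis
  proof (cases "CARD('n) = 1")
    case True
    obtain i :: 'n where i: "UNIV = {i}" using True by (auto simp: card_1_singleton_iff)
    have n: "norm w = \<bar>w $ i\<bar>" for w :: "real ^ 'n"
      by (simp add: norm_vec_def L2_set_def i)
    have ext: "w = w'" if "w $ i = w' $ i" for w w' :: "real ^ 'n"
      using that i by (metis UNIV_I singletonD vec_eq_iff)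
    consider "x - y = x' - y'" | "x - y = y' - x'"
      using eq ext[of "x - y" "x' - y'"] ext[of "x - y" "y' - x'"] by (auto simp: n abs_if split: if_splits)
    then show ?thesis
    proof cases
      case 2
      then show ?thesis using red[of x y] red[of y' x'] pip_correlation2_commute[where \<phi> = \<phi>, OF sym, of M \<Xi> \<beta> x' y'] by simp
    qed (metis red)
  next
    case False
    then have "2 \<le> CARD('n)" by (metis One_nat_def Suc_1 Suc_leI le_neq_implies_less zero_less_card_finite)
    then obtain f where f: "orthogonal_transformation f" "det (matrix f) = 1" "f (x - y) = x' - y'"
      using rotation_exists[OF _ eq] by blast
    then have Q: "rotation_matrix (matrix f)" "matrix f *v z = f z" for z
      by (auto simp: rotation_matrix_def orthogonal_transformation_matrix orthogonal_transformation_linear matrix_works)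
    show ?thesis
      using pip_correlation2_rotate[OF pip inh fr iso rad Q(1), of "x - y" 0] red[of x y] red[of x' y']
      by (simp add: Q(2) f(3) orthogonal_transformation_linear[OF f(1)] linear_0)
  qed
qed

lemma pair_correlation_eq:
  fixes \<Xi> :: "'w \<Rightarrow> (real ^ 'n) set"
  assumes "PIP M \<Xi> \<beta> \<phi>" "inhibitory \<phi>" "finite_range \<phi>" "isotropic M \<Xi>" "radial \<phi>"
  shows "pair_correlation M \<Xi> \<beta> \<phi> (norm (x - y))
    = pip_correlation2 M \<Xi> \<beta> \<phi> x y / (intensity M \<Xi> (pip_intensity \<beta> \<phi>))\<^sup>2"
  unfolding pair_correlation_def
proof (rule the_equality)
  show "\<forall>x' y'. norm (x' - y') = norm (x - y) \<longrightarrow>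
      pip_correlation2 M \<Xi> \<beta> \<phi> x y / (intensity M \<Xi> (pip_intensity \<beta> \<phi>))\<^sup>2
    = pip_correlation2 M \<Xi> \<beta> \<phi> x' y' / (intensity M \<Xi> (pip_intensity \<beta> \<phi>))\<^sup>2"
    using pip_correlation2_radial[OF assms] by metis
qed blast


lemma G_tilde_nonneg:
  assumes "\<And>x. 0 \<le> \<phi> x" "inhibitory \<phi>"
  shows "0 \<le> G_tilde \<phi> x"
  unfolding G_tilde_def using assms
  by (intro Bochner_Integration.integral_nonneg) (simp add: inhibitory_def mult_le_one)

text \<open>From \<open>1 - a * b \<le> (1 - a) + (1 - b)\<close> for \<open>a, b \<le> 1\<close>. The bound is uniform in \<open>x\<close>, which
  makes the lower bound of the pair correlation integrable along rays.\<close>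

lemma G_tilde_le:
  fixes \<phi> :: "'a::euclidean_space \<Rightarrow> real"
  assumes "\<phi> \<in> borel_measurable borel" "\<And>x. 0 \<le> \<phi> x" "inhibitory \<phi>" "finite_range \<phi>"
  shows "G_tilde \<phi> x \<le> 2 * (\<integral>y. 1 - \<phi> y \<partial>lborel)"
proof -
  note r = retention_interaction[OF assms]
  note i = retention_integrable[OF r]
  have i0: "integrable lborel (\<lambda>y. 1 - \<phi> y)" using i[of 0] by simp
  have "G_tilde \<phi> x \<le> (\<integral>y. (1 - \<phi> y) + (1 - \<phi> (y - x)) \<partial>lborel)"
    unfolding G_tilde_def
  proof (rule integral_mono)
    show "integrable lborel (\<lambda>y. 1 - \<phi> y * \<phi> (y - x))"
      using retention_integrable[OF retention_pair_interaction[OF assms, of 0 x]] by simp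
    fix y
    have "0 \<le> (1 - \<phi> y) * (1 - \<phi> (y - x))" using assms(3) by (simp add: inhibitory_def)
    then show "1 - \<phi> y * \<phi> (y - x) \<le> (1 - \<phi> y) + (1 - \<phi> (y - x))" by (simp add: algebra_simps)
  qed (intro Bochner_Integration.integrable_add i i0)
  also have "\<dots> = (\<integral>y. 1 - \<phi> y \<partial>lborel) + (\<integral>y. 1 - \<phi> (y - x) \<partial>lborel)"
    using i i0 by (rule Bochner_Integration.integral_add[rotated])
  also have "(\<integral>y. 1 - \<phi> (y - x) \<partial>lborel) = (\<integral>y. 1 - \<phi> y \<partial>distr lborel borel (\<lambda>y. - x + y))"
    using assms(1) by (subst integral_distr) auto
  also have "distr lborel borel (\<lambda>y. - x + y) = lborel" by (rule lborel_distr_plus)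
  finally show ?thesis by simp
qed

lemma G_tilde_measurable:
  fixes \<phi> :: "'a::euclidean_space \<Rightarrow> real"
  assumes [measurable]: "\<phi> \<in> borel_measurable borel"
  shows "G_tilde \<phi> \<in> borel_measurable borel"
  unfolding G_tilde_def[abs_def] by measurable

text \<open>The void probability bounds for the retention function \<open>1 - \<phi> z * \<phi> (z - x)\<close>, whose
  integral is \<open>G_tilde \<phi> x\<close>. If \<open>lam\<close> were 0, all quotients would be 0 by convention and the
  inequalities trivial.\<close>

lemma pair_correlation_bounds:
  fixes \<Xi> :: "'w \<Rightarrow> (real ^ 'n) set" and lam :: real
  assumes pip: "PIP M \<Xi> \<beta> \<phi>" and inh: "inhibitory \<phi>" and fr: "finite_range \<phi>"
    and iso: "isotropic M \<Xi>" and rad: "radial \<phi>"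
  defines "lam \<equiv> intensity M \<Xi> (pip_intensity \<beta> \<phi>)"
  shows "\<phi> x * (\<beta>\<^sup>2 / lam\<^sup>2 - \<beta>\<^sup>2 * G_tilde \<phi> x / lam) \<le> pair_correlation M \<Xi> \<beta> \<phi> (norm x)"
    and "pair_correlation M \<Xi> \<beta> \<phi> (norm x)
      \<le> \<phi> x * (\<beta>\<^sup>2 / lam\<^sup>2 - \<beta> / lam * (1 - exp (- \<beta> * G_tilde \<phi> x)))"
proof -
  interpret repulsive_gibbs M \<Xi> "pip_intensity \<beta> \<phi>" \<beta> by (rule repulsive_gibbs_PIP[OF pip inh fr])
  have p: "\<phi> \<in> borel_measurable borel" "\<And>x. 0 \<le> \<phi> x" "\<phi> (- x) = \<phi> x" using pip by (auto simp: PIP_def)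
  let ?u = "\<lambda>z. 1 - \<phi> (z - 0) * \<phi> (z - x)"
  define V where "V = expectation (\<lambda>\<omega>. void_prod ?u (\<Xi> \<omega>))"
  have r: "retention ?u" by (rule retention_pair_interaction[OF p(1,2) inh fr])
  have c: "expectation (\<lambda>\<omega>. pip_intensity \<beta> \<phi> y (\<Xi> \<omega>)) = lam" for y
    unfolding lam_def by (rule PIP_intensity_const[OF pip inh fr])
  have G: "(\<integral>z. ?u z \<partial>lborel) = G_tilde \<phi> x" by (simp add: G_tilde_def)
  have b: "1 - lam * G_tilde \<phi> x \<le> V" "V \<le> 1 - lam / \<beta> * (1 - exp (- \<beta> * G_tilde \<phi> x))"
    using void_probability_ge[OF r c] void_probability_le[OF r c] unfolding G V_def by auto
  have "pair_correlation M \<Xi> \<beta> \<phi> (norm (0 - x)) = \<phi> x * (\<beta>\<^sup>2 / lam\<^sup>2 * V)"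
    unfolding pair_correlation_eq[OF pip inh fr iso rad] pip_correlation2_void_prod lam_def[symmetric] V_def[symmetric]
    by (simp add: p(3))
  then have \<rho>: "pair_correlation M \<Xi> \<beta> \<phi> (norm x) = \<phi> x * (\<beta>\<^sup>2 / lam\<^sup>2 * V)" by simp
  have k: "0 \<le> \<beta>\<^sup>2 / lam\<^sup>2" by simp
  have "\<beta>\<^sup>2 / lam\<^sup>2 * (1 - lam * G_tilde \<phi> x) = \<beta>\<^sup>2 / lam\<^sup>2 - \<beta>\<^sup>2 * G_tilde \<phi> x / lam"
    by (cases "lam = 0") (simp_all add: power2_eq_square field_simps)
  then show "\<phi> x * (\<beta>\<^sup>2 / lam\<^sup>2 - \<beta>\<^sup>2 * G_tilde \<phi> x / lam) \<le> pair_correlation M \<Xi> \<beta> \<phi> (norm x)"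
    unfolding \<rho> using mult_left_mono[OF b(1) k] p(2)[of x] by (intro mult_left_mono) auto
  have "\<beta>\<^sup>2 / lam\<^sup>2 * (1 - lam / \<beta> * (1 - exp (- \<beta> * G_tilde \<phi> x)))
      = \<beta>\<^sup>2 / lam\<^sup>2 - \<beta> / lam * (1 - exp (- \<beta> * G_tilde \<phi> x))"
    using \<beta>_pos by (cases "lam = 0") (simp_all add: power2_eq_square field_simps)
  then show "pair_correlation M \<Xi> \<beta> \<phi> (norm x)
      \<le> \<phi> x * (\<beta>\<^sup>2 / lam\<^sup>2 - \<beta> / lam * (1 - exp (- \<beta> * G_tilde \<phi> x)))"
    unfolding \<rho> using mult_left_mono[OF b(2) k] p(2)[of x] by (intro mult_left_mono) auto
qed

section \<open>Bounds on the \<open>K\<close> function\<close>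

lemma radial_integral_mono:
  assumes "f \<in> borel_measurable borel" "g \<in> borel_measurable borel"
    and bounds: "\<And>s. 0 \<le> s \<Longrightarrow> \<bar>f s\<bar> \<le> C" "\<And>s. 0 \<le> s \<Longrightarrow> \<bar>g s\<bar> \<le> C"
    and le: "\<And>s. 0 \<le> s \<Longrightarrow> f s \<le> g s"
  shows "radial_integral TYPE('a::euclidean_space) f t \<le> radial_integral TYPE('a) g t"
proof -
  let ?k = "DIM('a) - 1"
  have int: "set_integrable lborel {0..t} (\<lambda>s. s ^ ?k * h s)"
    if [measurable]: "h \<in> borel_measurable borel" and h: "\<And>s. 0 \<le> s \<Longrightarrow> \<bar>h s\<bar> \<le> C" for h
    unfolding set_integrable_def
  proof (rule integrableI_bounded_set[where A = "{0..t}" and B = "t ^ ?k * C"])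
    show "AE s in lborel. s \<in> {0..t} \<longrightarrow> norm (indicator {0..t} s *\<^sub>R (s ^ ?k * h s)) \<le> t ^ ?k * C"
    proof (intro AE_I2 impI)
      fix s assume s: "s \<in> {0..t}"
      then have "\<bar>s ^ ?k\<bar> * \<bar>h s\<bar> \<le> t ^ ?k * C"
        using h[of s] by (intro mult_mono) (auto simp: power_abs power_mono)
      then show "norm (indicator {0..t} s *\<^sub>R (s ^ ?k * h s)) \<le> t ^ ?k * C"
        using s by (simp add: abs_mult)
    qed
  qed (auto simp: indicator_def emeasure_lborel_Icc_eq)
  have "(LINT s:{0..t}|lborel. s ^ ?k * f s) \<le> (LINT s:{0..t}|lborel. s ^ ?k * g s)"
    using assms by (intro set_integral_mono int) (auto intro!: mult_left_mono)
  then show ?thesis unfolding radial_integral_def by (intro mult_left_mono) auto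
qed

theorem mainTheorem5:
  fixes M :: "'w measure" and \<Xi> :: "'w \<Rightarrow> (real ^ 'n) set"
    and \<beta> lam :: real and \<phi> :: "real ^ 'n \<Rightarrow> real" and L U :: "real ^ 'n \<Rightarrow> real"
  assumes "PIP M \<Xi> \<beta> \<phi>" and "isotropic M \<Xi>" and "radial \<phi>"
    and "inhibitory \<phi>" and "finite_range \<phi>"
  defines "lam \<equiv> intensity M \<Xi> (pip_intensity \<beta> \<phi>)"
    and "L \<equiv> \<lambda>x. \<phi> x * (\<beta>\<^sup>2 / lam\<^sup>2 - \<beta>\<^sup>2 * G_tilde \<phi> x / lam)"
    and "U \<equiv> \<lambda>x. \<phi> x * (\<beta>\<^sup>2 / lam\<^sup>2 - \<beta> / lam * (1 - exp (- \<beta> * G_tilde \<phi> x)))"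
  shows "(\<forall>x. L x \<le> pair_correlation M \<Xi> \<beta> \<phi> (norm x) \<and>
              pair_correlation M \<Xi> \<beta> \<phi> (norm x) \<le> U x) \<and>
         (\<forall>t\<ge>0. \<forall>e. norm e = 1 \<longrightarrow>
            radial_integral TYPE(real ^ 'n) (\<lambda>s. L (s *\<^sub>R e)) t \<le> K_function M \<Xi> \<beta> \<phi> t \<and>
            K_function M \<Xi> \<beta> \<phi> t \<le> radial_integral TYPE(real ^ 'n) (\<lambda>s. U (s *\<^sub>R e)) t)"
proof -
  let ?\<rho> = "pair_correlation M \<Xi> \<beta> \<phi>"
  have [measurable]: "\<phi> \<in> borel_measurable borel" and \<phi>0: "\<And>x. 0 \<le> \<phi> x" and \<beta>: "0 < \<beta>"
    using assms(1) by (auto simp: PIP_def)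
  have \<phi>1: "\<phi> x \<le> 1" for x using assms(4) by (simp add: inhibitory_def)
  note [measurable] = G_tilde_measurable[of \<phi>]
  have bounds: "L x \<le> ?\<rho> (norm x)" "?\<rho> (norm x) \<le> U x" for x
    using pair_correlation_bounds[OF assms(1,4,5,2,3)] by (simp_all add: L_def U_def lam_def)
  have Lm: "L \<in> borel_measurable borel" and Um: "U \<in> borel_measurable borel"
    unfolding L_def U_def by measurable
  define A where "A = \<beta>\<^sup>2 / lam\<^sup>2 + \<bar>\<beta>\<^sup>2 / lam\<bar> * (2 * (\<integral>y. 1 - \<phi> y \<partial>lborel))"
  define B where "B = \<beta>\<^sup>2 / lam\<^sup>2 + \<bar>\<beta> / lam\<bar>"
  have G: "0 \<le> G_tilde \<phi> x" "G_tilde \<phi> x \<le> 2 * (\<integral>y. 1 - \<phi> y \<partial>lborel)" for x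
    using G_tilde_nonneg[OF \<phi>0 assms(4)] G_tilde_le[OF _ \<phi>0 assms(4,5)] by auto
  \<comment> \<open>The radial integrals are monotone only on integrable functions, so \<open>L\<close> and \<open>U\<close> need bounds in
    absolute value; here \<open>0 \<le> \<phi> \<le> 1\<close> and the bounds on \<open>G_tilde\<close> enter.\<close>
  have LA: "\<bar>L x\<bar> \<le> A" for x
  proof -
    have "\<bar>\<beta>\<^sup>2 / lam\<^sup>2 - \<beta>\<^sup>2 / lam * G_tilde \<phi> x\<bar> \<le> \<bar>\<beta>\<^sup>2 / lam\<^sup>2\<bar> + \<bar>\<beta>\<^sup>2 / lam * G_tilde \<phi> x\<bar>"
      by (rule abs_triangle_ineq4)
    also have "\<dots> \<le> A"
      unfolding A_def abs_mult using G[of x] by (intro add_mono mult_left_mono) auto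
    finally show ?thesis
      unfolding L_def abs_mult using \<phi>0[of x] \<phi>1[of x]
      by (simp add: mult_left_le_one_le order_trans[OF mult_left_le_one_le])
  qed
  have UB: "\<bar>U x\<bar> \<le> B" for x
  proof -
    have "\<bar>\<beta>\<^sup>2 / lam\<^sup>2 - \<beta> / lam * (1 - exp (- \<beta> * G_tilde \<phi> x))\<bar>
        \<le> \<bar>\<beta>\<^sup>2 / lam\<^sup>2\<bar> + \<bar>\<beta> / lam * (1 - exp (- \<beta> * G_tilde \<phi> x))\<bar>"
      by (rule abs_triangle_ineq4)
    also have "\<dots> \<le> B"
      unfolding B_def abs_mult using G(1)[of x] \<beta> by (intro add_mono mult_left_le) auto
    finally show ?thesis
      unfolding U_def abs_mult using \<phi>0[of x] \<phi>1[of x]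
      by (simp add: mult_left_le_one_le order_trans[OF mult_left_le_one_le])
  qed
  have K: "radial_integral TYPE(real ^ 'n) (\<lambda>s. L (s *\<^sub>R e)) t \<le> K_function M \<Xi> \<beta> \<phi> t"
      "K_function M \<Xi> \<beta> \<phi> t \<le> radial_integral TYPE(real ^ 'n) (\<lambda>s. U (s *\<^sub>R e)) t"
    if e: "norm e = 1" for t and e :: "real ^ 'n"
  proof -
    \<comment> \<open>\<open>?\<rho>\<close> is unspecified at negative arguments, where its measurability would be unclear; the
      quotient \<open>?r\<close> agrees with it on \<open>{0..t}\<close> and is measurable everywhere.\<close>
    let ?r = "\<lambda>s. pip_correlation2 M \<Xi> \<beta> \<phi> (s *\<^sub>R e) 0 / lam\<^sup>2"
    have r: "?\<rho> s = ?r s" "norm (s *\<^sub>R e) = s" if "0 \<le> s" for s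
      using pair_correlation_eq[OF assms(1,4,5,2,3), of "s *\<^sub>R e" 0] that e by (simp_all add: lam_def)
    have cm: "(\<lambda>p. pip_correlation2 M \<Xi> \<beta> \<phi> (fst p) (snd p)) \<in> borel_measurable (borel \<Otimes>\<^sub>M borel)"
      using PIP_correlation2[OF assms(1,5,4)] by (simp add: is_second_correlation_def case_prod_beta')
    have "(\<lambda>s. (s *\<^sub>R e, 0 :: real ^ 'n)) \<in> measurable borel (borel \<Otimes>\<^sub>M borel)" by measurable
    from measurable_compose[OF this cm] have rm: "?r \<in> borel_measurable borel" by simp
    have lm: "(\<lambda>s. L (s *\<^sub>R e)) \<in> borel_measurable borel" "(\<lambda>s. U (s *\<^sub>R e)) \<in> borel_measurable borel"
      using measurable_compose[OF _ Lm, of "\<lambda>s. s *\<^sub>R e"] measurable_compose[OF _ Um, of "\<lambda>s. s *\<^sub>R e"] by auto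
    have le: "L (s *\<^sub>R e) \<le> ?r s" "?r s \<le> U (s *\<^sub>R e)" if "0 \<le> s" for s
      using bounds[of "s *\<^sub>R e"] r[OF that] by simp_all
    have b: "\<bar>L (s *\<^sub>R e)\<bar> \<le> max A B" "\<bar>U (s *\<^sub>R e)\<bar> \<le> max A B" for s
      using LA UB by (auto intro: max.coboundedI1 max.coboundedI2)
    have rb: "\<bar>?r s\<bar> \<le> max A B" if "0 \<le> s" for s
      using le[OF that] b[of s] by linarith
    have "K_function M \<Xi> \<beta> \<phi> t = radial_integral TYPE(real ^ 'n) ?r t"
      unfolding K_function_def radial_integral_def using r(1)
      by (intro arg_cong[where f = "(*) _"] set_lebesgue_integral_cong) auto
    then show "radial_integral TYPE(real ^ 'n) (\<lambda>s. L (s *\<^sub>R e)) t \<le> K_function M \<Xi> \<beta> \<phi> t"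
      "K_function M \<Xi> \<beta> \<phi> t \<le> radial_integral TYPE(real ^ 'n) (\<lambda>s. U (s *\<^sub>R e)) t"
      using radial_integral_mono[OF lm(1) rm b(1) rb le(1)] radial_integral_mono[OF rm lm(2) rb b(2) le(2)] by simp_all
  qed
  show ?thesis using bounds K by blast
qed

end
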